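(* Let $n>4$ be an integer, let $K$ be a field, let $S_n=K[x_1,\ldots,x_n]$, let $B$ be a collection of $3$-blocks of $[n]$, and let $M_B\subseteq S_n$ be the block ideal of $B$. Then $([n],B)$ is an $\mathrm{STS}(n)$ if and only if $$b_1(S_n/M_B)=\frac{n(n-1)}{6}\quad\text{and}\quad b_2(S_n/M_B)=\binom{n(n-1)/6}{2}.$$
   Context: $[n]=\{1,\ldots,n\}$. A $k$-block of $[n]$ is a $k$-element subset of $[n]$; a collection of $k$-blocks is a set of distinct $k$-blocks. A Steiner system $S(t,k,n)$ is a pair $([n],B)$ where $B$ is a collection of $k$-blocks of $[n]$ such that every $t$-block of $[n]$ is contained in a unique $k$-block in $B$. An $\mathrm{STS}(n)$ (Steiner triple system) is an $S(2,3,n)$. For a collection $B$ of $k$-blocks of $[n]$, the block ideal $M_B$ is the squarefree monomial ideal of $S_n$ whose minimal generators are the monomials $x_{i_1}\cdots x_{i_k}$ with $\{i_1,\ldots,i_k\}\in B$. For a monomial ideal $M$ of $S_n$, $b_i(S_n/M)$ denotes the $i$-th (total) Betti number of $S_n/M$, i.e. the rank of the free module in homological degree $i$ of the minimal (multigraded) free resolution of $S_n/M$ over $S_n$ (so homological degree $0$ corresponds to $S_n$ itself and $b_1$ is the number of minimal generators of $M$). *)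

theory Defs
  imports Complex_Main "HOL-Library.Poly_Mapping"
begin

definition blocks :: "nat \<Rightarrow> nat \<Rightarrow> nat set set" where
  "blocks k n = {b. b \<subseteq> {1..n} \<and> card b = k}"

definition steiner_system :: "nat \<Rightarrow> nat \<Rightarrow> nat \<Rightarrow> nat set set \<Rightarrow> bool" where
  "steiner_system t k n B \<longleftrightarrow> B \<subseteq> blocks k n \<and> (\<forall>T\<in>blocks t n. \<exists>!b. b \<in> B \<and> T \<subseteq> b)"

definition STS :: "nat \<Rightarrow> nat set set \<Rightarrow> bool" where
  "STS n B \<longleftrightarrow> steiner_system 2 3 n B"

text \<open>Exponent vectors are finitely supported maps from variable indices to natural numbers,
  polynomials are finitely supported maps from exponent vectors to coefficients, and the product is
  the convolution product of the theory Poly_Mapping. The ring \<open>K[x_1, ..., x_n]\<close> is the subring of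
  the polynomials that involve only the variables with index in \<open>{1..n}\<close>.\<close>

type_synonym expo = "nat \<Rightarrow>\<^sub>0 nat"

type_synonym 'k mpoly = "expo \<Rightarrow>\<^sub>0 'k"

definition poly_ring :: "nat \<Rightarrow> 'k::zero mpoly set" where
  "poly_ring n = {p. \<forall>m\<in>Poly_Mapping.keys p. Poly_Mapping.keys m \<subseteq> {1..n}}"

definition block_monomial :: "nat set \<Rightarrow> 'k::field mpoly" where
  "block_monomial b = Poly_Mapping.single (\<Sum>i\<in>b. Poly_Mapping.single i 1) 1"

text \<open>The ideal of \<open>K[x_1, ..., x_n]\<close> generated by the block monomials, for a (necessarily finite)
  collection \<open>B\<close> of blocks of \<open>{1..n}\<close>. If all blocks have the same size, no block monomial divides
  another one, so these generators are the minimal monomial generators.\<close>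

definition block_ideal :: "nat \<Rightarrow> nat set set \<Rightarrow> 'k::field mpoly set" where
  "block_ideal n B =
     {\<Sum>b\<in>B. c b * block_monomial b | c. \<forall>b\<in>B. c b \<in> poly_ring n}"

text \<open>The free module of rank \<open>r\<close> over \<open>K[x_1, ..., x_n]\<close>; vectors are padded with zeros.\<close>

definition free_module :: "nat \<Rightarrow> nat \<Rightarrow> (nat \<Rightarrow> 'k::field mpoly) set" where
  "free_module n r = {v. (\<forall>j<r. v j \<in> poly_ring n) \<and> (\<forall>j\<ge>r. v j = 0)}"

definition mat_map ::
  "nat \<Rightarrow> nat \<Rightarrow> (nat \<Rightarrow> nat \<Rightarrow> 'k::field mpoly) \<Rightarrow> (nat \<Rightarrow> 'k mpoly) \<Rightarrow> (nat \<Rightarrow> 'k mpoly)" where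
  "mat_map r s A v = (\<lambda>j. if j < r then \<Sum>k<s. A j k * v k else 0)"

text \<open>A multigraded free resolution
    \<open>... \<rightarrow> F_2 \<rightarrow> F_1 \<rightarrow> F_0 = S_n \<rightarrow> S_n/M \<rightarrow> 0\<close>
  by free modules of finite rank. \<open>F_i\<close> has rank \<open>r i\<close>, its \<open>j\<close>-th basis element has multidegree
  \<open>dg i j\<close>, and \<open>d (Suc i)\<close> is the matrix of the differential from \<open>F_(i+1)\<close> to \<open>F_i\<close>; the value
  of \<open>d 0\<close> is irrelevant. The augmentation from \<open>S_n\<close> to \<open>S_n/M\<close> is the quotient map, so exactness
  at \<open>F_0\<close> says that the image of \<open>F_1\<close> in \<open>S_n\<close> is \<open>M\<close>. The conjunct on the keys of the matrix entries says that the
  differentials preserve multidegrees.\<close>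

definition multigraded_free_resolution ::
  "nat \<Rightarrow> 'k::field mpoly set \<Rightarrow> (nat \<Rightarrow> nat) \<Rightarrow> (nat \<Rightarrow> nat \<Rightarrow> expo)
     \<Rightarrow> (nat \<Rightarrow> nat \<Rightarrow> nat \<Rightarrow> 'k mpoly) \<Rightarrow> bool" where
  "multigraded_free_resolution n M r dg d \<longleftrightarrow>
     r 0 = 1 \<and> dg 0 0 = 0 \<and>
     (\<forall>i. \<forall>j<r i. Poly_Mapping.keys (dg i j) \<subseteq> {1..n}) \<and>
     (\<forall>i. \<forall>j<r i. \<forall>k<r (Suc i). d (Suc i) j k \<in> poly_ring n \<and>
        (\<forall>m\<in>Poly_Mapping.keys (d (Suc i) j k). m + dg i j = dg (Suc i) k)) \<and>
     (\<lambda>v. mat_map (r 0) (r 1) (d 1) v 0) ` free_module n (r 1) = M \<and>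
     (\<forall>i. {v \<in> free_module n (r (Suc i)). mat_map (r i) (r (Suc i)) (d (Suc i)) v = (\<lambda>_. 0)}
        = mat_map (r (Suc i)) (r (Suc (Suc i))) (d (Suc (Suc i)))
            ` free_module n (r (Suc (Suc i))))"

text \<open>Minimality: the image of each \<open>F_(i+1)\<close> lies in \<open>(x_1, ..., x_n) F_i\<close>, i.e. all matrix
  entries have zero constant term. Such a resolution exists for every proper monomial ideal.\<close>

definition minimal_free_resolution ::
  "nat \<Rightarrow> 'k::field mpoly set \<Rightarrow> (nat \<Rightarrow> nat) \<Rightarrow> (nat \<Rightarrow> nat \<Rightarrow> expo)
     \<Rightarrow> (nat \<Rightarrow> nat \<Rightarrow> nat \<Rightarrow> 'k mpoly) \<Rightarrow> bool" where
  "minimal_free_resolution n M r dg d \<longleftrightarrow>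
     multigraded_free_resolution n M r dg d \<and>
     (\<forall>i. \<forall>j<r i. \<forall>k<r (Suc i). Poly_Mapping.lookup (d (Suc i) j k) 0 = 0)"

text \<open>The total Betti number \<open>b_i(S_n/M)\<close> of a proper monomial ideal \<open>M\<close> of \<open>K[x_1, ..., x_n]\<close>.\<close>

definition betti :: "nat \<Rightarrow> 'k::field mpoly set \<Rightarrow> nat \<Rightarrow> nat" where
  "betti n M i = (THE b. \<exists>r dg d. minimal_free_resolution n M r dg d \<and> r i = b)"

end

theory Submission
  imports Defs
begin

text \<open>
  By Nakayama's lemma \<open>b_1\<close> and \<open>b_2\<close> are the minimal numbers of generators of the ideal and of the
  module of syzygies of its generators; in particular \<open>b_1 = |B|\<close>. The syzygies of the
  block monomials are generated by the pair syzygies, one for every two blocks. The syzygy of \<open>a\<close> and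
  \<open>b\<close> is redundant as soon as a third block is contained in \<open>a \<union> b\<close>, and if this never happens the pair
  syzygies are minimal generators. Hence \<open>b_2\<close> equals \<open>|B|\<close> choose 2 if and only if no block is covered
  by two others. In a cover-free family of triples, a block that meets another one in two vertices
  has a vertex contained in no other block. Deleting such vertices inductively shows
  \<open>6 |B| \<le> n (n - 1)\<close>, and for \<open>n > 4\<close> equality excludes them, so that any two blocks
  meet in at most one vertex and counting pairs gives a Steiner triple system.

  The resolution itself exists because the multigraded syzygies of a finite family of multidegrees
  \<open>g j\<close> are generated in the degrees \<open>lcm {g j | j \<in> T}\<close>.
\<close>

text \<open>A block \<open>c\<close> lies in \<open>a \<union> b\<close> exactly when its monomial
  divides the least common multiple of those of \<open>a\<close> and \<open>b\<close>; this is where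
  algebra and combinatorics meet. Deleting a block together with a vertex of its own lowers
  \<open>n (n - 1)\<close> by \<open>2 (n - 1)\<close>. This is at least 6 for
  \<open>n >= 4\<close>, which gives the bound by induction, and exceeds 6 for \<open>n > 4\<close>,
  which rules such blocks out in the case of equality. Two distinct triples of a 4-set are
  cover-free and attain equality without forming a Steiner system, so \<open>n = 4\<close> has to be
  excluded. As \<open>betti\<close> is a definite description, a minimal resolution must be shown to
  exist and its first ranks to be unique. Uniqueness is obtained by comparing every resolution with
  the block monomials: minimal monomial generators are unique up to order and scalars, so
  \<open>r 2\<close> always counts minimal generators of essentially the same module of
  syzygies.\<close>

abbreviation coeff :: "('a \<Rightarrow>\<^sub>0 'b::zero) \<Rightarrow> 'a \<Rightarrow> 'b" where
  "coeff \<equiv> Poly_Mapping.lookup"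

abbreviation mon :: "'a \<Rightarrow> 'b::zero \<Rightarrow> 'a \<Rightarrow>\<^sub>0 'b" where
  "mon \<equiv> Poly_Mapping.single"

subsection \<open>Monomials and divisibility of exponents\<close>

text \<open>The library's order \<open>\<le>\<close> on \<open>expo\<close> is lexicographic, not divisibility.\<close>

definition edvd :: "expo \<Rightarrow> expo \<Rightarrow> bool" where
  "edvd a m \<longleftrightarrow> (\<forall>i. coeff a i \<le> coeff m i)"

lemma edvd_refl [simp]: "edvd a a"
  by (simp add: edvd_def)

lemma edvd_trans: "edvd a b \<Longrightarrow> edvd b c \<Longrightarrow> edvd a c"
  unfolding edvd_def using le_trans by blast

lemma edvd_antisym: "edvd a b \<Longrightarrow> edvd b a \<Longrightarrow> a = b"
  by (simp add: edvd_def poly_mapping_eqI le_antisym)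

lemma edvd_0_iff [simp]: "edvd a 0 \<longleftrightarrow> a = 0"
  by (auto simp: edvd_def intro: poly_mapping_eqI)

lemma edvd_add [simp]: "edvd a (a + b)" "edvd a (b + a)"
  by (auto simp: edvd_def lookup_add)

lemma edvd_diff_add: "edvd a m \<Longrightarrow> m - a + a = m"
  by (rule poly_mapping_eqI) (simp add: edvd_def lookup_add lookup_minus)

lemma add_eq_iff_edvd: "u + a = m \<longleftrightarrow> edvd a m \<and> u = m - a" for a u m :: expo
  by (metis add_diff_cancel_right' edvd_add(2) edvd_diff_add)

lemma edvd_diff_diff:
  "edvd a b \<Longrightarrow> edvd b c \<Longrightarrow> c - b + (b - a) = c - a"
  by (rule poly_mapping_eqI) (simp add: edvd_def lookup_add lookup_minus)

lemma keys_add_expo: "Poly_Mapping.keys (a + b) = Poly_Mapping.keys a \<union> Poly_Mapping.keys b" for a b :: expo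
  by (auto simp: in_keys_iff lookup_add)

lemma keys_diff_expo: "Poly_Mapping.keys (a - b) \<subseteq> Poly_Mapping.keys a" for a b :: expo
  by (auto simp: in_keys_iff lookup_minus)

definition elcm :: "expo \<Rightarrow> expo \<Rightarrow> expo" where
  "elcm a b = a + (b - a)"

lemma lookup_elcm: "coeff (elcm a b) i = max (coeff a i) (coeff b i)"
  by (simp add: elcm_def lookup_add lookup_minus)

lemma edvd_elcm [simp]: "edvd a (elcm a b)" "edvd b (elcm a b)"
  by (simp_all add: edvd_def lookup_elcm)

lemma elcm_least: "edvd a m \<Longrightarrow> edvd b m \<Longrightarrow> edvd (elcm a b) m"
  by (simp add: edvd_def lookup_elcm)

lemma elcm_commute: "elcm a b = elcm b a"
  by (rule poly_mapping_eqI) (simp add: lookup_elcm max.commute)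

lemma finite_lcm_exists:
  fixes g :: "'j \<Rightarrow> expo"
  assumes "finite T" and "\<And>j. j \<in> T \<Longrightarrow> Poly_Mapping.keys (g j) \<subseteq> V"
  shows "\<exists>L. Poly_Mapping.keys L \<subseteq> V \<and> (\<forall>j\<in>T. edvd (g j) L)
      \<and> (\<forall>m. (\<forall>j\<in>T. edvd (g j) m) \<longrightarrow> edvd L m)"
  using assms
proof (induction rule: finite_induct)
  case empty
  show ?case by (rule exI[of _ 0]) (simp add: edvd_def)
next
  case (insert x F)
  then obtain L where L: "Poly_Mapping.keys L \<subseteq> V" "\<forall>j\<in>F. edvd (g j) L"
    "\<And>m. (\<forall>j\<in>F. edvd (g j) m) \<Longrightarrow> edvd L m" by auto
  have "Poly_Mapping.keys (elcm (g x) L) \<subseteq> V"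
    unfolding elcm_def keys_add_expo using keys_diff_expo[of L "g x"] L(1) insert.prems by blast
  moreover have "\<forall>j\<in>insert x F. edvd (g j) (elcm (g x) L)"
    using L(2) edvd_trans edvd_elcm by blast
  ultimately show ?case using L(3) elcm_least by blast
qed

section \<open>Coefficients of products\<close>

lemma poly_mapping_sum_single: "(\<Sum>u\<in>Poly_Mapping.keys p. mon u (coeff p u)) = p"
  by (rule poly_mapping_eqI) (auto simp: lookup_sum lookup_single when_def in_keys_iff)

text \<open>Subtraction of exponents truncates at 0, so \<open>m - a\<close> is the preimage of
  \<open>m\<close> under the shift by \<open>a\<close> only if \<open>a\<close> divides
  \<open>m\<close>; otherwise no term of \<open>p\<close> is shifted to \<open>m\<close>.\<close>

lemma coeff_mult_single:
  fixes p :: "expo \<Rightarrow>\<^sub>0 'k::comm_ring_1"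
  shows "coeff (p * mon a c) m = (if edvd a m then coeff p (m - a) * c else 0)"
proof -
  have "coeff (p * mon a c) m
      = (\<Sum>u\<in>Poly_Mapping.keys p. coeff (mon u (coeff p u) * mon a c) m)"
    by (subst (1) poly_mapping_sum_single[of p, symmetric]) (simp add: sum_distrib_right lookup_sum)
  also have "\<dots> = (\<Sum>u\<in>Poly_Mapping.keys p. if u = m - a then (if edvd a m then coeff p u * c else 0) else 0)"
    by (rule sum.cong) (auto simp: mult_single lookup_single when_def add_eq_iff_edvd)
  also have "\<dots> = (if edvd a m then coeff p (m - a) * c else 0)"
    by (simp add: in_keys_iff)
  finally show ?thesis .
qed

text \<open>Only 0 divides 0. Taking constant terms is thus reduction modulo
  \<open>(x_1, ..., x_n)\<close>, on which the minimality arguments rest.\<close>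

lemma coeff_mult_0:
  fixes p q :: "expo \<Rightarrow>\<^sub>0 'k::comm_ring_1"
  shows "coeff (p * q) 0 = coeff p 0 * coeff q 0"
proof -
  have "coeff (p * q) 0 = (\<Sum>u\<in>Poly_Mapping.keys q. coeff (p * mon u (coeff q u)) 0)"
    by (subst (1) poly_mapping_sum_single[of q, symmetric]) (simp add: sum_distrib_left lookup_sum)
  also have "\<dots> = (\<Sum>u\<in>Poly_Mapping.keys q. if u = 0 then coeff p 0 * coeff q 0 else 0)"
    by (rule sum.cong) (auto simp: coeff_mult_single)
  also have "\<dots> = coeff p 0 * coeff q 0"
    by (simp add: in_keys_iff)
  finally show ?thesis .
qed

lemma single_keys_subset:
  assumes "Poly_Mapping.keys p \<subseteq> {u}"
  shows "p = mon u (coeff p u)"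
proof (rule poly_mapping_eqI)
  fix k show "coeff p k = coeff (mon u (coeff p u)) k"
    using assms by (cases "k = u") (auto simp: lookup_single in_keys_iff)
qed

subsection \<open>The polynomial ring as a subring\<close>

lemma poly_ring_0 [simp]: "0 \<in> poly_ring n"
  by (simp add: poly_ring_def)

lemma poly_ring_add: "p \<in> poly_ring n \<Longrightarrow> q \<in> poly_ring n \<Longrightarrow> p + q \<in> poly_ring n"
  unfolding poly_ring_def using keys_add[of p q] by blast

lemma poly_ring_uminus: "p \<in> poly_ring n \<Longrightarrow> - p \<in> poly_ring n"
  for p :: "'k::field mpoly"
  by (simp add: poly_ring_def in_keys_iff)

lemma poly_ring_diff: "p \<in> poly_ring n \<Longrightarrow> q \<in> poly_ring n \<Longrightarrow> p - q \<in> poly_ring n"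
  for p :: "'k::field mpoly"
  using poly_ring_add[OF _ poly_ring_uminus, of p n q] by simp

lemma poly_ring_mult: "p \<in> poly_ring n \<Longrightarrow> q \<in> poly_ring n \<Longrightarrow> p * q \<in> poly_ring n"
  for p :: "'k::field mpoly"
  unfolding poly_ring_def using keys_mult[of p q] by (fastforce simp: keys_add_expo)

lemma poly_ring_sum: "(\<And>i. i \<in> I \<Longrightarrow> f i \<in> poly_ring n) \<Longrightarrow> sum f I \<in> poly_ring n"
  for f :: "'i \<Rightarrow> 'k::field mpoly"
  by (induction I rule: infinite_finite_induct) (auto simp: poly_ring_add)

lemma poly_ring_single [simp]: "Poly_Mapping.keys m \<subseteq> {1..n} \<Longrightarrow> mon m c \<in> poly_ring n"
  by (simp add: poly_ring_def)

lemma poly_ring_1 [simp]: "1 \<in> poly_ring n"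
  by (simp flip: single_one)

lemmas poly_ring_closed = poly_ring_add poly_ring_uminus poly_ring_diff poly_ring_mult poly_ring_sum

subsection \<open>Spans and syzygies of finite families\<close>

definition poly_span :: "nat \<Rightarrow> 'j set \<Rightarrow> ('j \<Rightarrow> 'i \<Rightarrow> 'k::field mpoly) \<Rightarrow> ('i \<Rightarrow> 'k mpoly) set" where
  "poly_span n J A = {\<lambda>i. \<Sum>j\<in>J. c j * A j i | c. \<forall>j\<in>J. c j \<in> poly_ring n}"

text \<open>The value 0 outside \<open>J\<close> is the padding of \<open>free_module\<close>, so
  that these sets can be compared directly with kernels and spans of vectors.\<close>

definition syz :: "nat \<Rightarrow> 'j set \<Rightarrow> ('j \<Rightarrow> 'i \<Rightarrow> 'k::field mpoly) \<Rightarrow> ('j \<Rightarrow> 'k mpoly) set" where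
  "syz n J A = {c. (\<forall>j\<in>J. c j \<in> poly_ring n) \<and> (\<forall>j. j \<notin> J \<longrightarrow> c j = 0)
      \<and> (\<forall>i. (\<Sum>j\<in>J. c j * A j i) = 0)}"

text \<open>In the homogeneous case this is minimality of the generators: a unit in a syzygy would
  express one of them through the others.\<close>

definition no_unit_syz :: "nat \<Rightarrow> 'j set \<Rightarrow> ('j \<Rightarrow> 'i \<Rightarrow> 'k::field mpoly) \<Rightarrow> bool" where
  "no_unit_syz n J A \<longleftrightarrow> (\<forall>c\<in>syz n J A. \<forall>j. coeff (c j) 0 = 0)"

lemma poly_spanI:
  "(\<And>j. j \<in> J \<Longrightarrow> c j \<in> poly_ring n) \<Longrightarrow> v = (\<lambda>i. \<Sum>j\<in>J. c j * A j i) \<Longrightarrow> v \<in> poly_span n J A"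
  unfolding poly_span_def by blast

lemma poly_spanE:
  assumes "v \<in> poly_span n J A"
  obtains c where "\<And>j. j \<in> J \<Longrightarrow> c j \<in> poly_ring n" "\<And>i. v i = (\<Sum>j\<in>J. c j * A j i)"
proof -
  from assms obtain c where "\<forall>j\<in>J. c j \<in> poly_ring n" "v = (\<lambda>i. \<Sum>j\<in>J. c j * A j i)"
    unfolding poly_span_def by blast
  then show ?thesis by (intro that[of c]) auto
qed

lemma poly_span_0: "(\<lambda>i. 0) \<in> poly_span n J A"
  by (rule poly_spanI[of _ "\<lambda>_. 0"]) auto

lemma poly_span_add:
  assumes "u \<in> poly_span n J A" "v \<in> poly_span n J A"
  shows "(\<lambda>i. u i + v i) \<in> poly_span n J A"
proof -
  obtain c where c: "\<And>j. j \<in> J \<Longrightarrow> c j \<in> poly_ring n" "\<And>i. u i = (\<Sum>j\<in>J. c j * A j i)"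
    using assms(1) by (elim poly_spanE) blast
  obtain d where d: "\<And>j. j \<in> J \<Longrightarrow> d j \<in> poly_ring n" "\<And>i. v i = (\<Sum>j\<in>J. d j * A j i)"
    using assms(2) by (elim poly_spanE) blast
  from c d show ?thesis
    by (intro poly_spanI[of _ "\<lambda>j. c j + d j"]) (auto simp: poly_ring_add distrib_right sum.distrib)
qed

lemma poly_span_scale:
  assumes "p \<in> poly_ring n" "v \<in> poly_span n J A"
  shows "(\<lambda>i. p * v i) \<in> poly_span n J A"
proof -
  obtain d where "\<And>j. j \<in> J \<Longrightarrow> d j \<in> poly_ring n" "\<And>i. v i = (\<Sum>j\<in>J. d j * A j i)"
    using assms(2) by (elim poly_spanE) blast
  then show ?thesis
    using assms(1)
    by (intro poly_spanI[of _ "\<lambda>j. p * d j"]) (auto simp: poly_ring_mult sum_distrib_left mult.assoc)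
qed

lemma poly_span_uminus: "v \<in> poly_span n J A \<Longrightarrow> (\<lambda>i. - v i) \<in> poly_span n J A"
  using poly_span_scale[of "-1" n v J A] by (simp add: poly_ring_uminus)

lemma poly_span_sum:
  assumes "\<And>x. x \<in> X \<Longrightarrow> f x \<in> poly_span n J A"
  shows "(\<lambda>i. \<Sum>x\<in>X. f x i) \<in> poly_span n J A"
  using assms by (induction X rule: infinite_finite_induct) (auto simp: poly_span_0 poly_span_add)

lemma poly_span_base:
  assumes "finite J" "k \<in> J"
  shows "A k \<in> poly_span n J A"
  using assms
  by (intro poly_spanI[of _ "\<lambda>j. if j = k then 1 else 0"]) (auto simp: if_distrib[of "\<lambda>x. x * _"] cong: if_cong)

lemma poly_span_least:
  assumes "\<And>j. j \<in> J \<Longrightarrow> A j \<in> poly_span n J' A'"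
  shows "poly_span n J A \<subseteq> poly_span n J' A'"
proof
  fix v assume "v \<in> poly_span n J A"
  then obtain c where c: "\<And>j. j \<in> J \<Longrightarrow> c j \<in> poly_ring n" "\<And>i. v i = (\<Sum>j\<in>J. c j * A j i)"
    by (elim poly_spanE) blast
  have "(\<lambda>i. \<Sum>j\<in>J. c j * A j i) \<in> poly_span n J' A'"
    using c(1) assms by (intro poly_span_sum poly_span_scale)
  moreover have "v = (\<lambda>i. \<Sum>j\<in>J. c j * A j i)"
    using c(2) by (rule ext)
  ultimately show "v \<in> poly_span n J' A'" by simp
qed

lemma poly_span_reindex:
  assumes "bij_betw f J' J"
  shows "poly_span n J' (\<lambda>j. A (f j)) = poly_span n J A"
proof
  show "poly_span n J' (\<lambda>j. A (f j)) \<subseteq> poly_span n J A"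
  proof
    fix v assume "v \<in> poly_span n J' (\<lambda>j. A (f j))"
    then obtain c where c: "\<And>j. j \<in> J' \<Longrightarrow> c j \<in> poly_ring n" "\<And>i. v i = (\<Sum>j\<in>J'. c j * A (f j) i)"
      by (elim poly_spanE) blast
    let ?g = "inv_into J' f"
    have "bij_betw ?g J J'" using assms by (rule bij_betw_inv_into)
    then have "v i = (\<Sum>j\<in>J. c (?g j) * A (f (?g j)) i)" for i
      using sum.reindex_bij_betw[of ?g J J' "\<lambda>j. c j * A (f j) i"] c(2) by simp
    moreover have "f (?g j) = j" if "j \<in> J" for j
      using assms that by (simp add: bij_betw_inv_into_right)
    ultimately have "v i = (\<Sum>j\<in>J. c (?g j) * A j i)" for i by simp
    moreover have "c (?g j) \<in> poly_ring n" if "j \<in> J" for j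
      using c(1) \<open>bij_betw ?g J J'\<close> that by (auto simp: bij_betw_def)
    ultimately show "v \<in> poly_span n J A" by (intro poly_spanI[of _ "\<lambda>j. c (?g j)"]) auto
  qed
next
  show "poly_span n J A \<subseteq> poly_span n J' (\<lambda>j. A (f j))"
  proof
    fix v assume "v \<in> poly_span n J A"
    then obtain c where c: "\<And>j. j \<in> J \<Longrightarrow> c j \<in> poly_ring n" "\<And>i. v i = (\<Sum>j\<in>J. c j * A j i)"
      by (elim poly_spanE) blast
    then show "v \<in> poly_span n J' (\<lambda>j. A (f j))"
      using assms sum.reindex_bij_betw[OF assms, of "\<lambda>j. c j * A j _"]
      by (intro poly_spanI[of _ "\<lambda>j. c (f j)"]) (auto simp: bij_betw_def)
  qed
qed

lemma poly_span_remove: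
  assumes J: "finite J" and k: "A k \<in> poly_span n (J - {k}) A"
  shows "poly_span n (J - {k}) A = poly_span n J A"
proof
  show "poly_span n (J - {k}) A \<subseteq> poly_span n J A"
    using J by (intro poly_span_least poly_span_base) auto
  show "poly_span n J A \<subseteq> poly_span n (J - {k}) A"
  proof (rule poly_span_least)
    fix j assume "j \<in> J"
    then show "A j \<in> poly_span n (J - {k}) A"
      using J k by (cases "j = k") (auto intro: poly_span_base)
  qed
qed

lemma syzD:
  assumes "c \<in> syz n J A"
  shows "c j \<in> poly_ring n" "j \<notin> J \<Longrightarrow> c j = 0" "(\<Sum>j\<in>J. c j * A j i) = 0"
  using assms by (cases "j \<in> J"; simp add: syz_def)+

lemma syzI:
  assumes "\<And>j. j \<in> J \<Longrightarrow> c j \<in> poly_ring n" "\<And>j. j \<notin> J \<Longrightarrow> c j = 0"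
    "\<And>i. (\<Sum>j\<in>J. c j * A j i) = 0"
  shows "c \<in> syz n J A"
  using assms by (simp add: syz_def)

lemma poly_span_subset_syz:
  assumes "\<And>k. k \<in> P \<Longrightarrow> G k \<in> syz n J A"
  shows "poly_span n P G \<subseteq> syz n J A"
proof
  fix v assume "v \<in> poly_span n P G"
  then obtain c where c: "\<And>j. j \<in> P \<Longrightarrow> c j \<in> poly_ring n" "\<And>i. v i = (\<Sum>j\<in>P. c j * G j i)"
    by (elim poly_spanE) blast
  show "v \<in> syz n J A"
  proof (rule syzI)
    fix j show "v j \<in> poly_ring n"
      unfolding c by (intro poly_ring_sum poly_ring_mult c(1) syzD(1)[OF assms])
  next
    fix j assume "j \<notin> J" then show "v j = 0"
      unfolding c using syzD(2)[OF assms] by (simp add: sum.neutral)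
  next
    fix i
    have "(\<Sum>j\<in>J. v j * A j i) = (\<Sum>k\<in>P. c k * (\<Sum>j\<in>J. G k j * A j i))"
      unfolding c sum_distrib_left sum_distrib_right by (subst sum.swap) (simp add: mult.assoc)
    also have "\<dots> = 0"
      using syzD(3)[OF assms] by (simp add: sum.neutral)
    finally show "(\<Sum>j\<in>J. v j * A j i) = 0" .
  qed
qed

lemma poly_span_cong: "(\<And>j. j \<in> J \<Longrightarrow> A j = A' j) \<Longrightarrow> poly_span n J A = poly_span n J A'"
  by (simp add: poly_span_def cong: sum.cong)

lemma syz_cong: "(\<And>j. j \<in> J \<Longrightarrow> A j = A' j) \<Longrightarrow> syz n J A = syz n J A'"
  by (simp add: syz_def cong: sum.cong)

lemma no_unit_syz_reindex:
  assumes f: "bij_betw f J' J" and min: "no_unit_syz n J A"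
  shows "no_unit_syz n J' (\<lambda>j. A (f j))"
  unfolding no_unit_syz_def
proof (intro ballI allI)
  fix c k assume c: "c \<in> syz n J' (\<lambda>j. A (f j))"
  define c' where "c' j = (if j \<in> J then c (inv_into J' f j) else 0)" for j
  have c'f: "c' (f j) = c j" if "j \<in> J'" for j
    using f that by (auto simp: c'_def bij_betw_def)
  have "c' \<in> syz n J A"
  proof (rule syzI)
    fix j show "c' j \<in> poly_ring n" using syzD(1)[OF c] by (simp add: c'_def)
  next
    fix i
    have "(\<Sum>j\<in>J. c' j * A j i) = (\<Sum>j\<in>J'. c' (f j) * A (f j) i)"
      using sum.reindex_bij_betw[OF f, of "\<lambda>j. c' j * A j i"] by simp
    also have "\<dots> = 0" using syzD(3)[OF c] c'f by simp
    finally show "(\<Sum>j\<in>J. c' j * A j i) = 0" .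
  qed (simp add: c'_def)
  then have "coeff (c' (f k)) 0 = 0" using min by (simp add: no_unit_syz_def)
  then show "coeff (c k) 0 = 0" using c'f[of k] syzD(2)[OF c] by (cases "k \<in> J'") auto
qed

subsection \<open>Nakayama's lemma\<close>

lemma homogeneous_system_nontrivial:
  fixes Q :: "'a \<Rightarrow> 'b \<Rightarrow> 'k::field"
  assumes "finite I" "finite J" "card J < card I"
  shows "\<exists>x. (\<exists>i\<in>I. x i \<noteq> 0) \<and> (\<forall>j\<in>J. (\<Sum>i\<in>I. Q j i * x i) = 0)"
  using assms(2,1,3)
proof (induction J arbitrary: I Q rule: finite_induct)
  case empty
  then obtain i where "i \<in> I" by fastforce
  then show ?case by (intro exI[of _ "\<lambda>_. 1"]) auto
next
  case (insert j0 J)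
  show ?case
  proof (cases "\<forall>i\<in>I. Q j0 i = 0")
    case True
    then show ?thesis using insert.IH[of I Q] insert.hyps insert.prems by (auto simp: card_insert_if)
  next
    case False
    then obtain i0 where i0: "i0 \<in> I" "Q j0 i0 \<noteq> 0" by blast
    define I' where "I' = I - {i0}"
    have I: "I = insert i0 I'" "i0 \<notin> I'" "finite I'" using i0 insert.prems by (auto simp: I'_def)
    \<comment> \<open>\<open>Q'\<close> is the system after equation \<open>j0\<close> has been
      solved for the pivot unknown \<open>i0\<close>; a solution of it extends by the value
      \<open>- s\<close> at \<open>i0\<close>.\<close>
    define Q' where "Q' j i = Q j i - Q j i0 * Q j0 i / Q j0 i0" for j i
    have "card J < card I'" using insert.prems insert.hyps I by auto
    from insert.IH[OF I(3) this, of Q'] obtain x where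
      x: "\<exists>i\<in>I'. x i \<noteq> 0" "\<And>j. j \<in> J \<Longrightarrow> (\<Sum>i\<in>I'. Q' j i * x i) = 0" by blast
    define s where "s = (\<Sum>i\<in>I'. Q j0 i * x i) / Q j0 i0"
    define y where "y i = (if i = i0 then - s else x i)" for i
    have y: "(\<Sum>i\<in>I. Q j i * y i) = - Q j i0 * s + (\<Sum>i\<in>I'. Q j i * x i)" for j
    proof -
      have "(\<Sum>i\<in>I'. Q j i * y i) = (\<Sum>i\<in>I'. Q j i * x i)"
        using I(2) by (intro sum.cong) (auto simp: y_def)
      then show ?thesis using I by (simp add: y_def)
    qed
    have "(\<Sum>i\<in>I. Q j i * y i) = 0" if "j \<in> insert j0 J" for j
    proof (cases "j = j0")
      case True
      then show ?thesis using i0 by (simp add: y s_def)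
    next
      case False
      with that have "(\<Sum>i\<in>I'. Q' j i * x i) = 0" using x(2) by blast
      then have "(\<Sum>i\<in>I'. Q j i * x i) = Q j i0 * s"
        by (simp add: Q'_def s_def left_diff_distrib sum_subtractf sum_distrib_left
            sum_divide_distrib mult.assoc)
      then show ?thesis by (simp add: y)
    qed
    moreover have "\<exists>i\<in>I. y i \<noteq> 0" using x(1) I by (auto simp: y_def)
    ultimately show ?thesis by blast
  qed
qed

text \<open>Nakayama's lemma in numerical form: modulo \<open>(x_1, ..., x_n)\<close> the identity
  of size \<open>card J\<close> factors through a space of dimension \<open>card P\<close>. As
  \<open>P\<close> is any family with the same span, \<open>J\<close> has the least possible
  cardinality.\<close>

lemma card_le_of_no_unit_syz:
  fixes A :: "'j \<Rightarrow> 'i \<Rightarrow> 'k::field mpoly" and G :: "'p \<Rightarrow> 'i \<Rightarrow> 'k mpoly"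
  assumes J: "finite J" and P: "finite P" and eq: "poly_span n J A = poly_span n P G"
    and min: "no_unit_syz n J A"
  shows "card J \<le> card P"
proof (rule ccontr)
  assume "\<not> card J \<le> card P"
  have "\<exists>c. (\<forall>p\<in>P. c p \<in> poly_ring n) \<and> (\<forall>i. A j i = (\<Sum>p\<in>P. c p * G p i))" if "j \<in> J" for j
    using poly_span_base[OF J that, of A n] unfolding eq by (elim poly_spanE) blast
  then obtain a where a: "\<And>j p. j \<in> J \<Longrightarrow> p \<in> P \<Longrightarrow> a j p \<in> poly_ring n"
    "\<And>j i. j \<in> J \<Longrightarrow> A j i = (\<Sum>p\<in>P. a j p * G p i)" by metis
  have "\<exists>c. (\<forall>j\<in>J. c j \<in> poly_ring n) \<and> (\<forall>i. G p i = (\<Sum>j\<in>J. c j * A j i))" if "p \<in> P" for p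
    using poly_span_base[OF P that, of G n] unfolding eq[symmetric] by (elim poly_spanE) blast
  then obtain g where g: "\<And>j p. j \<in> J \<Longrightarrow> p \<in> P \<Longrightarrow> g p j \<in> poly_ring n"
    "\<And>p i. p \<in> P \<Longrightarrow> G p i = (\<Sum>j\<in>J. g p j * A j i)" by metis
  obtain x where x: "\<exists>j\<in>J. x j \<noteq> 0" "\<And>p. p \<in> P \<Longrightarrow> (\<Sum>j\<in>J. coeff (a j p) 0 * x j) = 0"
    using homogeneous_system_nontrivial[OF J P, of "\<lambda>p j. coeff (a j p) 0"] \<open>\<not> card J \<le> card P\<close>
    by auto
  text \<open>The constant terms of the matrix product \<open>g a\<close> form the identity matrix, because each column
    of \<open>g a - 1\<close> is a syzygy; this contradicts the kernel vector \<open>x\<close> of the matrix of constant terms of \<open>a\<close>.\<close>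
  have id: "(\<Sum>p\<in>P. coeff (a j p) 0 * coeff (g p k) 0) = (if k = j then 1 else 0)"
    if "j \<in> J" "k \<in> J" for j k
  proof -
    define c where "c l = (if l \<in> J then (\<Sum>p\<in>P. a j p * g p l) - (if l = j then 1 else 0) else 0)" for l
    have "c \<in> syz n J A"
    proof (rule syzI)
      fix l assume "l \<in> J" then show "c l \<in> poly_ring n"
        using a(1) g(1) \<open>j \<in> J\<close> by (auto simp: c_def intro!: poly_ring_closed)
    next
      fix i
      have "(\<Sum>l\<in>J. c l * A l i) = (\<Sum>l\<in>J. (\<Sum>p\<in>P. a j p * (g p l * A l i)) - (if l = j then A l i else 0))"
        by (rule sum.cong) (auto simp: c_def left_diff_distrib sum_distrib_right mult.assoc)
      also have "\<dots> = (\<Sum>p\<in>P. a j p * (\<Sum>l\<in>J. g p l * A l i)) - A j i"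
        using J \<open>j \<in> J\<close> by (subst sum_subtractf, subst sum.swap) (simp add: sum_distrib_left)
      also have "\<dots> = 0" using a(2) g(2) \<open>j \<in> J\<close> by simp
      finally show "(\<Sum>l\<in>J. c l * A l i) = 0" .
    qed (simp add: c_def)
    then have "coeff (c k) 0 = 0" using min by (simp add: no_unit_syz_def)
    then show ?thesis
      using \<open>k \<in> J\<close> by (auto simp: c_def lookup_minus lookup_sum coeff_mult_0 split: if_splits)
  qed
  obtain k where k: "k \<in> J" "x k \<noteq> 0" using x(1) by blast
  have "(\<Sum>j\<in>J. (\<Sum>p\<in>P. coeff (a j p) 0 * coeff (g p k) 0) * x j)
      = (\<Sum>p\<in>P. coeff (g p k) 0 * (\<Sum>j\<in>J. coeff (a j p) 0 * x j))"
    unfolding sum_distrib_left sum_distrib_right by (subst sum.swap) (simp add: mult_ac)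
  also have "\<dots> = 0" using x(2) by simp
  finally have "(\<Sum>j\<in>J. (if k = j then 1 else 0) * x j) = 0"
    using id k(1) by simp
  then show False using k J by (simp add: if_distrib[of "\<lambda>y. y * _"] cong: if_cong)
qed

subsection \<open>Multigraded components\<close>

text \<open>\<open>h\<close> and \<open>g\<close> are the degrees of the basis elements of target
  and source. Exponents are cancellative, so every entry is a scalar times a single monomial, and
  the graded arguments reduce to linear algebra over the field.\<close>

definition homogeneous :: "('i \<Rightarrow> expo) \<Rightarrow> ('j \<Rightarrow> expo) \<Rightarrow> 'j set \<Rightarrow> ('j \<Rightarrow> 'i \<Rightarrow> 'k::zero mpoly) \<Rightarrow> bool" where
  "homogeneous h g J A \<longleftrightarrow> (\<forall>j\<in>J. \<forall>i. \<forall>m\<in>Poly_Mapping.keys (A j i). m + h i = g j)"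

text \<open>The component in degree \<open>m\<close> of a polynomial regarded as a coefficient of a basis element of degree \<open>h\<close>.\<close>

definition component :: "expo \<Rightarrow> expo \<Rightarrow> 'k::zero mpoly \<Rightarrow> 'k mpoly" where
  "component h m p = mon (m - h) (if edvd h m then coeff p (m - h) else 0)"

lemma coeff_component: "coeff (component h m p) u = (if m = u + h then coeff p u else 0)"
  using add_eq_iff_edvd[of u h m] by (auto simp: component_def lookup_single when_def)

lemma component_0 [simp]: "component h m 0 = 0"
  by (simp add: component_def)

lemma component_sum: "component h m (sum f X) = (\<Sum>x\<in>X. component h m (f x))"
  by (rule poly_mapping_eqI) (simp add: coeff_component lookup_sum)

lemma component_poly_ring: "p \<in> poly_ring n \<Longrightarrow> component h m p \<in> poly_ring n"
  by (auto simp: poly_ring_def in_keys_iff coeff_component split: if_splits)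

text \<open>As \<open>a\<close> is zero or a scalar times one monomial, multiplying by it moves each
  term of \<open>c\<close> to one term of the product; the drop of the basis degree from
  \<open>g\<close> to \<open>h\<close> compensates exactly for this shift.\<close>

lemma component_mult:
  fixes c a :: "'k::field mpoly"
  assumes "\<And>u. u \<in> Poly_Mapping.keys a \<Longrightarrow> u + h = g"
  shows "component g m c * a = component h m (c * a)"
proof (cases "a = 0")
  case False
  then obtain u where u: "u \<in> Poly_Mapping.keys a" by (metis keys_eq_empty ex_in_conv)
  have g: "g = u + h" using assms u by simp
  have "Poly_Mapping.keys a \<subseteq> {u}" using assms unfolding g by auto
  then have "a = mon u (coeff a u)" by (rule single_keys_subset)
  then obtain x where a: "a = mon u x" ..
  show ?thesis
  proof (rule poly_mapping_eqI)
    fix w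
    show "coeff (component g m c * a) w = coeff (component h m (c * a)) w"
    proof (cases "edvd u w")
      case True
      then have "w - u + g = w + h" using edvd_diff_add[of u w] unfolding g by (metis add.assoc)
      then show ?thesis using True unfolding a coeff_component coeff_mult_single by simp
    next
      case False
      then show ?thesis unfolding a coeff_component coeff_mult_single by simp
    qed
  qed
qed simp

lemma syz_component:
  assumes "homogeneous h g J A" and c: "c \<in> syz n J A"
  shows "(\<lambda>j. component (g j) m (c j)) \<in> syz n J A"
proof (rule syzI)
  fix j show "component (g j) m (c j) \<in> poly_ring n" using syzD(1)[OF c] by (rule component_poly_ring)
next
  fix j assume "j \<notin> J" then show "component (g j) m (c j) = 0" using syzD(2)[OF c] by simp
next
  fix i
  have "(\<Sum>j\<in>J. component (g j) m (c j) * A j i) = (\<Sum>j\<in>J. component (h i) m (c j * A j i))"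
    using assms(1) by (intro sum.cong refl component_mult) (auto simp: homogeneous_def)
  also have "\<dots> = 0" by (simp add: syzD(3)[OF c] flip: component_sum)
  finally show "(\<Sum>j\<in>J. component (g j) m (c j) * A j i) = 0" .
qed

lemma sum_components:
  assumes "finite D" "\<And>u. u \<in> Poly_Mapping.keys p \<Longrightarrow> u + h \<in> D"
  shows "(\<Sum>m\<in>D. component h m p) = p"
  using assms by (intro poly_mapping_eqI) (auto simp: lookup_sum coeff_component in_keys_iff)

text \<open>A syzygy is the sum of its homogeneous components in the finitely many degrees
  \<open>D\<close> that occur in it, so only components have to be generated.\<close>

lemma syz_subset_poly_spanI:
  assumes J: "finite J" and hom: "homogeneous h g J A"
    and g: "\<And>j. j \<in> J \<Longrightarrow> Poly_Mapping.keys (g j) \<subseteq> {1..n}"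
    and *: "\<And>c m. c \<in> syz n J A \<Longrightarrow> Poly_Mapping.keys m \<subseteq> {1..n}
      \<Longrightarrow> (\<lambda>j. component (g j) m (c j)) \<in> poly_span n P G"
  shows "syz n J A \<subseteq> poly_span n P G"
proof
  fix c assume c: "c \<in> syz n J A"
  define D where "D = (\<Union>j\<in>J. (\<lambda>u. u + g j) ` Poly_Mapping.keys (c j))"
  have D: "finite D" using J by (simp add: D_def)
  have "Poly_Mapping.keys m \<subseteq> {1..n}" if "m \<in> D" for m
    using that g syzD(1)[OF c] by (fastforce simp: D_def keys_add_expo poly_ring_def)
  then have "(\<lambda>j. \<Sum>m\<in>D. component (g j) m (c j)) \<in> poly_span n P G"
    using *[OF c] by (intro poly_span_sum) auto
  moreover have "(\<Sum>m\<in>D. component (g j) m (c j)) = c j" for j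
  proof (cases "j \<in> J")
    case True
    then show ?thesis using D by (intro sum_components) (auto simp: D_def)
  next
    case False
    then show ?thesis using syzD(2)[OF c] by simp
  qed
  ultimately show "c \<in> poly_span n P G" by simp
qed

subsection \<open>Finite generation of multigraded syzygies\<close>

text \<open>Induction on the number of coordinates: the vectors vanishing at one coordinate
  \<open>x\<close> form a subspace \<open>V'\<close> of codimension at most 1, so its spanning set
  needs at most one further vector \<open>w\<close>.\<close>

lemma subspace_finite_spanning_set:
  fixes V :: "('j \<Rightarrow> 'k::field) set"
  assumes "finite J" and "\<And>v j. v \<in> V \<Longrightarrow> j \<notin> J \<Longrightarrow> v j = 0"
    and "\<And>v w x. v \<in> V \<Longrightarrow> w \<in> V \<Longrightarrow> (\<lambda>j. v j + x * w j) \<in> V"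
  shows "\<exists>S. finite S \<and> S \<subseteq> V \<and> (\<forall>v\<in>V. \<exists>a. \<forall>j. v j = (\<Sum>b\<in>S. a b * b j))"
  using assms
proof (induction J arbitrary: V rule: finite_induct)
  case empty
  then show ?case by (intro exI[of _ "{}"]) auto
next
  case (insert x J)
  define V' where "V' = {v \<in> V. v x = 0}"
  have "\<exists>S. finite S \<and> S \<subseteq> V' \<and> (\<forall>v\<in>V'. \<exists>a. \<forall>j. v j = (\<Sum>b\<in>S. a b * b j))"
    proof (rule insert.IH)
    show "v j = 0" if "v \<in> V'" "j \<notin> J" for v j
      using that insert.prems(1)[of v j] by (cases "j = x") (auto simp: V'_def)
    show "(\<lambda>j. v j + y * w j) \<in> V'" if "v \<in> V'" "w \<in> V'" for v w y
      using that insert.prems(2)[of v w y] by (simp add: V'_def)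
  qed
  then obtain S where S: "finite S" "S \<subseteq> V'" "\<And>v. v \<in> V' \<Longrightarrow> \<exists>a. \<forall>j. v j = (\<Sum>b\<in>S. a b * b j)"
    by blast
  show ?case
  proof (cases "V = V'")
    case True
    with S show ?thesis by blast
  next
    case False
    then obtain w where w: "w \<in> V" "w x \<noteq> 0" by (auto simp: V'_def)
    have "\<exists>a. \<forall>j. v j = (\<Sum>b\<in>insert w S. a b * b j)" if v: "v \<in> V" for v
    proof -
      have "(\<lambda>j. v j + (- v x / w x) * w j) \<in> V'"
        using insert.prems(2)[OF v w(1), of "- v x / w x"] w(2) by (simp add: V'_def)
      from S(3)[OF this] obtain a where
        a: "\<And>j. v j + (- v x / w x) * w j = (\<Sum>b\<in>S. a b * b j)" by auto
      have "w \<notin> S" using S(2) w(2) by (auto simp: V'_def)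
      then have "(\<Sum>b\<in>insert w S. (if b = w then v x / w x else a b) * b j)
          = v x / w x * w j + (\<Sum>b\<in>S. a b * b j)" for j
        using S(1) by (simp add: sum.insert) (rule sum.cong, auto)
      then have "v j = (\<Sum>b\<in>insert w S. (if b = w then v x / w x else a b) * b j)" for j
        unfolding a[symmetric] by simp
      then show ?thesis by (intro exI[of _ "\<lambda>b. if b = w then v x / w x else a b"] allI)
    qed
    then show ?thesis using S w(1) by (intro exI[of _ "insert w S"]) (auto simp: V'_def)
  qed
qed

lemma mult_single_eq_0D:
  fixes p :: "'k::field mpoly"
  assumes "mon u 1 * p = 0"
  shows "p = 0"
proof (rule poly_mapping_eqI)
  fix w
  have "coeff (p * mon u 1) (w + u) = 0" using assms by (metis mult.commute lookup_zero)
  then show "coeff p w = coeff 0 w" by (simp add: coeff_mult_single)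
qed

text \<open>A generator is indexed by a set \<open>T\<close> of basis elements, which determines its
  degree \<open>L T\<close>, and by its vector \<open>b\<close> of scalars in that degree. There are
  finitely many \<open>T\<close> and a finite spanning set of vectors for each.\<close>

lemma syz_finitely_generated:
  fixes A :: "'j \<Rightarrow> 'i \<Rightarrow> 'k::field mpoly"
  assumes J: "finite J" and hom: "homogeneous h g J A"
    and g: "\<And>j. j \<in> J \<Longrightarrow> Poly_Mapping.keys (g j) \<subseteq> {1..n}"
  shows "\<exists>(P :: ('j set \<times> ('j \<Rightarrow> 'k)) set) G dg. finite P \<and> homogeneous g dg P G
    \<and> (\<forall>p\<in>P. Poly_Mapping.keys (dg p) \<subseteq> {1..n}) \<and> poly_span n P G = syz n J A"
proof -
  have "\<exists>L. Poly_Mapping.keys L \<subseteq> {1..n} \<and> (\<forall>j\<in>T. edvd (g j) L)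
      \<and> (\<forall>m. (\<forall>j\<in>T. edvd (g j) m) \<longrightarrow> edvd L m)" if "T \<subseteq> J" for T
    using finite_lcm_exists[of T g "{1..n}"] g that finite_subset[OF that J] by blast
  then obtain L where L: "\<And>T. T \<subseteq> J \<Longrightarrow> Poly_Mapping.keys (L T) \<subseteq> {1..n}"
    "\<And>T j. T \<subseteq> J \<Longrightarrow> j \<in> T \<Longrightarrow> edvd (g j) (L T)"
    "\<And>T m. T \<subseteq> J \<Longrightarrow> (\<And>j. j \<in> T \<Longrightarrow> edvd (g j) m) \<Longrightarrow> edvd (L T) m" by metis
  text \<open>A homogeneous syzygy of degree \<open>m\<close> is a multiple of one of degree \<open>L T\<close>, where \<open>T\<close> is the
    set of basis elements whose degree divides \<open>m\<close>; in degree \<open>L T\<close> the syzygies form a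
    finite-dimensional space \<open>V T\<close>.\<close>
  define W where "W T c = (\<lambda>j. mon (L T - g j) (c j))" for T and c :: "'j \<Rightarrow> 'k"
  define V where "V T = {c. (\<forall>j. j \<notin> T \<longrightarrow> c j = 0) \<and> W T c \<in> syz n J A}" for T
  have W_add: "W T (\<lambda>j. v j + x * w j) = (\<lambda>j. W T v j + mon 0 x * W T w j)" for T v w x
    by (simp add: W_def single_add mult_single)
  have syz_add: "(\<lambda>j. v j + mon 0 x * w j) \<in> syz n J A" if "v \<in> syz n J A" "w \<in> syz n J A" for v w x
    using syzD[OF that(1)] syzD[OF that(2)]
    by (intro syzI)
      (auto simp: distrib_right sum.distrib mult.assoc poly_ring_closed simp flip: sum_distrib_left)
  have "\<exists>S. finite S \<and> S \<subseteq> V T \<and> (\<forall>v\<in>V T. \<exists>a. \<forall>j. v j = (\<Sum>b\<in>S. a b * b j))" if "T \<subseteq> J" for T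
  proof (rule subspace_finite_spanning_set)
    show "finite T" using that J finite_subset by blast
  qed (auto simp: V_def W_add intro: syz_add)
  then obtain S where S: "\<And>T. T \<subseteq> J \<Longrightarrow> finite (S T)" "\<And>T. T \<subseteq> J \<Longrightarrow> S T \<subseteq> V T"
    "\<And>T v. T \<subseteq> J \<Longrightarrow> v \<in> V T \<Longrightarrow> \<exists>a. \<forall>j. v j = (\<Sum>b\<in>S T. a b * b j)" by metis
  define P where "P = Sigma (Pow J) S"
  define G where "G = (\<lambda>(T, b). W T b)"
  define dg where "dg = (\<lambda>(T, b :: 'j \<Rightarrow> 'k). L T)"
  have P: "finite P" unfolding P_def using J S(1) by (intro finite_SigmaI) auto
  have "homogeneous g dg P G"
    unfolding homogeneous_def
  proof (intro ballI allI)
    fix p j m assume "p \<in> P" and m: "m \<in> Poly_Mapping.keys (G p j)"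
    then obtain T b where p: "p = (T, b)" "T \<subseteq> J" "b \<in> V T" using S(2) by (auto simp: P_def)
    have "b j \<noteq> 0" "m = L T - g j" using m by (auto simp: p(1) G_def W_def split: if_splits)
    then have "j \<in> T" using p(3) by (auto simp: V_def)
    then show "m + g j = dg p" using L(2)[OF p(2)] \<open>m = L T - g j\<close>
      by (simp add: p(1) dg_def edvd_diff_add)
  qed
  moreover have "\<forall>p\<in>P. Poly_Mapping.keys (dg p) \<subseteq> {1..n}"
    using L(1) by (auto simp: P_def dg_def)
  moreover have "poly_span n P G = syz n J A"
  proof
    show "poly_span n P G \<subseteq> syz n J A"
      using S(2) by (intro poly_span_subset_syz) (auto simp: P_def G_def V_def)
    show "syz n J A \<subseteq> poly_span n P G"
    proof (rule syz_subset_poly_spanI[OF J hom g])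
      fix c and m :: expo assume c: "c \<in> syz n J A" and m: "Poly_Mapping.keys m \<subseteq> {1..n}"
      define T where "T = {j\<in>J. edvd (g j) m}"
      define a where "a j = (if j \<in> T then coeff (c j) (m - g j) else 0)" for j
      have T: "T \<subseteq> J" by (auto simp: T_def)
      have Lm: "edvd (L T) m" using L(3)[OF T] by (simp add: T_def)
      \<comment> \<open>All entries in degree \<open>m\<close> carry the common factor
        \<open>mon (m - L T) 1\<close>; cancelling it shows that \<open>a\<close> already gives a
        syzygy in degree \<open>L T\<close>.\<close>
      have comp: "component (g j) m (c j) = mon (m - L T) 1 * W T a j" for j
        using syzD(2)[OF c, of j] edvd_diff_diff[OF L(2)[OF T, of j] Lm]
        by (auto simp: component_def W_def a_def mult_single T_def)
      have "W T a \<in> syz n J A"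
      proof (rule syzI)
        fix j assume "j \<in> J"
        then show "W T a j \<in> poly_ring n"
          using L(1)[OF T] keys_diff_expo[of "L T" "g j"] unfolding W_def by (intro poly_ring_single) blast
      next
        fix j assume "j \<notin> J" then show "W T a j = 0" by (simp add: W_def a_def T_def)
      next
        fix i
        have "mon (m - L T) 1 * (\<Sum>j\<in>J. W T a j * A j i) = (\<Sum>j\<in>J. component (g j) m (c j) * A j i)"
          by (simp add: comp sum_distrib_left mult.assoc)
        also have "\<dots> = 0" using syzD(3)[OF syz_component[OF hom c]] .
        finally show "(\<Sum>j\<in>J. W T a j * A j i) = 0" by (rule mult_single_eq_0D)
      qed
      then have "a \<in> V T" by (simp add: V_def a_def)
      from S(3)[OF T this] obtain x where x: "\<And>j. a j = (\<Sum>b\<in>S T. x b * b j)" by blast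
      have "mon u (sum f X) = (\<Sum>b\<in>X. mon u (f b))" for u :: expo and f :: "('j \<Rightarrow> 'k) \<Rightarrow> 'k" and X
        by (rule poly_mapping_eqI) (simp add: lookup_sum lookup_single when_def)
      then have "W T a = (\<lambda>j. \<Sum>b\<in>S T. mon 0 (x b) * G (T, b) j)"
        by (simp add: W_def G_def x mult_single)
      also have "\<dots> \<in> poly_span n P G"
        using P T by (intro poly_span_sum poly_span_scale poly_span_base) (auto simp: P_def)
      finally have "W T a \<in> poly_span n P G" .
      then show "(\<lambda>j. component (g j) m (c j)) \<in> poly_span n P G"
        unfolding comp using keys_diff_expo[of m "L T"] m
        by (intro poly_span_scale poly_ring_single) auto
    qed
  qed
  ultimately show ?thesis using P by blast
qed

lemma minimal_subfamily:
  assumes P: "finite P" and hom: "homogeneous g dg P G"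
  shows "\<exists>Q\<subseteq>P. poly_span n Q G = poly_span n P G \<and> no_unit_syz n Q G"
proof -
  let ?ok = "\<lambda>Q. Q \<subseteq> P \<and> poly_span n Q G = poly_span n P G"
  have "?ok P" by simp
  from ex_has_least_nat[of ?ok, OF this, of card] obtain Q
    where Q: "Q \<subseteq> P" "poly_span n Q G = poly_span n P G"
      and least: "\<And>R. ?ok R \<Longrightarrow> card Q \<le> card R"
    by (elim exE conjE) metis
  have finQ: "finite Q" using Q(1) P finite_subset by blast
  have hQ: "homogeneous g dg Q G" using hom Q(1) by (auto simp: homogeneous_def)
  have "no_unit_syz n Q G"
    unfolding no_unit_syz_def
  proof (intro ballI allI)
    fix c k assume c: "c \<in> syz n Q G"
    show "coeff (c k) 0 = 0"
    proof (rule ccontr)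
      assume e: "coeff (c k) 0 \<noteq> 0"
      then have k: "k \<in> Q" using syzD(2)[OF c] by force
      \<comment> \<open>The constant term of entry \<open>k\<close> has total degree
        \<open>dg k\<close>, so in this degree entry \<open>k\<close> is the scalar
        \<open>coeff (c k) 0\<close>.\<close>
      define c' where "c' j = component (dg j) (dg k) (c j)" for j
      have c': "c' \<in> syz n Q G" unfolding c'_def using syz_component[OF hQ c] .
      define e' where "e' = mon (0::expo) (inverse (coeff (c k) 0))"
      have "e' * c' k = 1"
        using e by (simp add: e'_def c'_def component_def mult_single)
      then have "G k i = (\<Sum>j\<in>Q - {k}. (- e' * c' j) * G j i)" for i
      proof -
        have "e' * (c' k * G k i + (\<Sum>j\<in>Q - {k}. c' j * G j i)) = 0"
          using syzD(3)[OF c', of i] sum.remove[OF finQ k, of "\<lambda>j. c' j * G j i"] by simp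
        then have "G k i + e' * (\<Sum>j\<in>Q - {k}. c' j * G j i) = 0"
          using \<open>e' * c' k = 1\<close> by (simp add: distrib_left flip: mult.assoc)
        then show ?thesis
          by (simp add: sum_negf sum_distrib_left mult.assoc eq_neg_iff_add_eq_0)
      qed
      then have "G k \<in> poly_span n (Q - {k}) G"
        using syzD(1)[OF c']
        by (intro poly_spanI[of _ "\<lambda>j. - e' * c' j"]) (auto simp: e'_def poly_ring_closed)
      then have "poly_span n (Q - {k}) G = poly_span n P G"
        using poly_span_remove[OF finQ] Q(2) by metis
      moreover have "Q - {k} \<subseteq> P" using Q(1) by auto
      ultimately show False using least[of "Q - {k}"] card_Diff1_less[OF finQ k] by simp
    qed
  qed
  with Q show ?thesis by blast
qed

lemma syz_minimal_generators:
  fixes A :: "'j \<Rightarrow> 'i \<Rightarrow> 'k::field mpoly"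
  assumes "finite J" and "homogeneous h g J A" and "\<And>j. j \<in> J \<Longrightarrow> Poly_Mapping.keys (g j) \<subseteq> {1..n}"
  shows "\<exists>t (G :: nat \<Rightarrow> 'j \<Rightarrow> 'k mpoly) dg. homogeneous g dg {..<t} G
    \<and> (\<forall>k<t. Poly_Mapping.keys (dg k) \<subseteq> {1..n}) \<and> poly_span n {..<t} G = syz n J A
    \<and> no_unit_syz n {..<t} G"
proof -
  obtain P :: "('j set \<times> ('j \<Rightarrow> 'k)) set" and G dg where P: "finite P" and hom: "homogeneous g dg P G"
    and dg: "\<forall>p\<in>P. Poly_Mapping.keys (dg p) \<subseteq> {1..n}" and eq: "poly_span n P G = syz n J A"
    using syz_finitely_generated[OF assms] by blast
  obtain Q where Q: "Q \<subseteq> P" "poly_span n Q G = syz n J A" "no_unit_syz n Q G"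
    using minimal_subfamily[OF P hom] eq by metis
  then have "finite Q" using P finite_subset by blast
  then obtain f where f: "bij_betw f {..<card Q} Q"
    using ex_bij_betw_nat_finite[of Q] by (auto simp: lessThan_atLeast0)
  then have fQ: "f k \<in> Q" if "k < card Q" for k using that by (auto simp: bij_betw_def)
  show ?thesis
  proof (intro exI conjI)
    show "homogeneous g (\<lambda>k. dg (f k)) {..<card Q} (\<lambda>k. G (f k))"
      using hom Q(1) fQ by (auto simp: homogeneous_def)
    show "\<forall>k<card Q. Poly_Mapping.keys (dg (f k)) \<subseteq> {1..n}"
      using dg Q(1) fQ by blast
    show "poly_span n {..<card Q} (\<lambda>k. G (f k)) = syz n J A"
      using poly_span_reindex[OF f, of n G] Q(2) by simp
    show "no_unit_syz n {..<card Q} (\<lambda>k. G (f k))"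
      using no_unit_syz_reindex[OF f Q(3)] .
  qed
qed

subsection \<open>Minimal free resolutions\<close>

text \<open>Matrices have the row index first, families of generators the index of the generator;
  the columns are the images of the basis elements.\<close>

definition cols :: "nat \<Rightarrow> (nat \<Rightarrow> nat \<Rightarrow> 'a::zero) \<Rightarrow> nat \<Rightarrow> nat \<Rightarrow> 'a" where
  "cols r A = (\<lambda>k j. if j < r then A j k else 0)"

lemma mat_map_cols: "mat_map r s A v = (\<lambda>j. \<Sum>k<s. v k * cols r A k j)"
  by (auto simp: mat_map_def cols_def fun_eq_iff mult.commute)

lemma mat_map_image: "mat_map r s A ` free_module n s = poly_span n {..<s} (cols r A)"
proof
  show "mat_map r s A ` free_module n s \<subseteq> poly_span n {..<s} (cols r A)"
    by (auto simp: mat_map_cols free_module_def intro: poly_spanI)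
  show "poly_span n {..<s} (cols r A) \<subseteq> mat_map r s A ` free_module n s"
  proof
    fix v assume "v \<in> poly_span n {..<s} (cols r A)"
    then obtain c where c: "\<And>k. k \<in> {..<s} \<Longrightarrow> c k \<in> poly_ring n"
      "\<And>j. v j = (\<Sum>k<s. c k * cols r A k j)" by (elim poly_spanE) blast
    have "v = mat_map r s A (\<lambda>k. if k < s then c k else 0)"
      unfolding mat_map_cols by (rule ext) (simp add: c(2))
    then show "v \<in> mat_map r s A ` free_module n s"
      using c(1) by (intro image_eqI) (auto simp: free_module_def)
  qed
qed

lemma mat_map_kernel:
  "{v \<in> free_module n s. mat_map r s A v = (\<lambda>_. 0)} = syz n {..<s} (cols r A)"
  by (auto simp: mat_map_cols free_module_def syz_def fun_eq_iff)

lemma resolution_exact: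
  assumes "multigraded_free_resolution n M r dg d"
  shows "syz n {..<r (Suc i)} (cols (r i) (d (Suc i)))
    = poly_span n {..<r (Suc (Suc i))} (cols (r (Suc i)) (d (Suc (Suc i))))"
  using assms unfolding multigraded_free_resolution_def mat_map_kernel mat_map_image by blast

lemma resolution_image:
  assumes "multigraded_free_resolution n M r dg d"
  shows "(\<lambda>v. v 0) ` poly_span n {..<r 1} (cols 1 (d 1)) = M"
  using assms unfolding multigraded_free_resolution_def mat_map_image[symmetric] image_image by auto

lemma resolution_homogeneous:
  assumes "multigraded_free_resolution n M r dg d"
  shows "homogeneous (dg i) (dg (Suc i)) {..<r (Suc i)} (cols (r i) (d (Suc i)))"
  using assms unfolding multigraded_free_resolution_def homogeneous_def cols_def by auto

text \<open>By exactness a syzygy of the columns is a combination of the columns of the next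
  differential, whose entries have no constant term.\<close>

lemma minimal_resolution_no_unit_syz:
  assumes "minimal_free_resolution n M r dg d"
  shows "no_unit_syz n {..<r (Suc i)} (cols (r i) (d (Suc i)))"
  unfolding no_unit_syz_def
proof (intro ballI allI)
  have res: "multigraded_free_resolution n M r dg d"
    and min: "\<And>i j k. j < r i \<Longrightarrow> k < r (Suc i) \<Longrightarrow> coeff (d (Suc i) j k) 0 = 0"
    using assms by (auto simp: minimal_free_resolution_def)
  fix c j assume "c \<in> syz n {..<r (Suc i)} (cols (r i) (d (Suc i)))"
  then obtain a where "c j = (\<Sum>k<r (Suc (Suc i)). a k * cols (r (Suc i)) (d (Suc (Suc i))) k j)"
    unfolding resolution_exact[OF res] by (elim poly_spanE) blast
  then show "coeff (c j) 0 = 0"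
    by (auto simp: lookup_sum coeff_mult_0 cols_def min intro!: sum.neutral)
qed

section \<open>Construction of a minimal resolution by iterated syzygies\<close>

lemma homogeneous_poly_ring:
  assumes "homogeneous h g J A" "j \<in> J" "Poly_Mapping.keys (g j) \<subseteq> {1..n}"
  shows "A j i \<in> poly_ring n"
  unfolding poly_ring_def
proof (intro CollectI ballI)
  fix m assume "m \<in> Poly_Mapping.keys (A j i)"
  then have "m + h i = g j" using assms by (auto simp: homogeneous_def)
  then show "Poly_Mapping.keys m \<subseteq> {1..n}" using assms(3) by (metis keys_add_expo le_sup_iff)
qed

text \<open>One differential with the invariants of the construction: \<open>s\<close> and
  \<open>g\<close> describe the target, \<open>t\<close> and \<open>g'\<close> the source, and
  \<open>G\<close> lists the columns. The invariant \<open>no_unit_syz\<close> is what keeps the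
  next differential free of constant terms.\<close>

definition stage :: "nat \<Rightarrow> nat \<times> (nat \<Rightarrow> expo) \<times> nat \<times> (nat \<Rightarrow> expo) \<times> (nat \<Rightarrow> nat \<Rightarrow> 'k::field mpoly) \<Rightarrow> bool" where
  "stage n = (\<lambda>(s, g, t, g', G).
     (\<forall>j<s. Poly_Mapping.keys (g j) \<subseteq> {1..n}) \<and> (\<forall>k<t. Poly_Mapping.keys (g' k) \<subseteq> {1..n}) \<and>
     homogeneous g g' {..<t} G \<and> no_unit_syz n {..<t} G \<and>
     (\<forall>k<t. \<forall>j. (s \<le> j \<longrightarrow> G k j = 0) \<and> coeff (G k j) 0 = 0))"

lemma stage_next:
  assumes "stage n (s, g, t, g', G)"
  shows "\<exists>u g'' H. stage n (t, g', u, g'', H) \<and> poly_span n {..<u} H = syz n {..<t} G"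
proof -
  have st: "\<And>k. k < t \<Longrightarrow> Poly_Mapping.keys (g' k) \<subseteq> {1..n}" "homogeneous g g' {..<t} G"
    "no_unit_syz n {..<t} G"
    using assms by (auto simp: stage_def)
  obtain u g'' and H :: "nat \<Rightarrow> nat \<Rightarrow> 'a mpoly" where H: "homogeneous g' g'' {..<u} H"
    "\<forall>k<u. Poly_Mapping.keys (g'' k) \<subseteq> {1..n}" "poly_span n {..<u} H = syz n {..<t} G"
    "no_unit_syz n {..<u} H"
    using syz_minimal_generators[OF _ st(2), of n] st(1) by blast
  have "H k \<in> syz n {..<t} G" if "k < u" for k
    using poly_span_base[of "{..<u}" k H n] that H(3) by auto
  then have "stage n (t, g', u, g'', H)"
    using H st syzD(2)[of "H _" n "{..<t}" G] by (auto simp: stage_def no_unit_syz_def)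
  with H(3) show ?thesis by blast
qed

lemma minimal_free_resolution_exists:
  fixes A :: "nat \<Rightarrow> nat \<Rightarrow> 'k::field mpoly"
  assumes stage: "stage n (1, \<lambda>_. 0, s, g, A)"
  shows "\<exists>r dg d. minimal_free_resolution n ((\<lambda>v. v 0) ` poly_span n {..<s} A) r dg d"
proof -
  let ?init = "(1, \<lambda>_. 0, s, g, A) :: nat \<times> (nat \<Rightarrow> expo) \<times> nat \<times> (nat \<Rightarrow> expo) \<times> (nat \<Rightarrow> nat \<Rightarrow> 'k mpoly)"
  let ?next = "\<lambda>(s, g, t, g', G) (s2, g2, t2, g2', G2).
    s2 = t \<and> g2 = g' \<and> poly_span n {..<t2} G2 = syz n {..<t} (G :: nat \<Rightarrow> nat \<Rightarrow> 'k mpoly)"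
  have "\<exists>f. \<forall>i. (stage n (f i) \<and> (i = 0 \<longrightarrow> f i = ?init)) \<and> ?next (f i) (f (Suc i))"
  proof (rule dependent_nat_choice)
    show "\<exists>x. stage n x \<and> ((0::nat) = 0 \<longrightarrow> x = ?init)" using stage by blast
  next
    fix x and i :: nat
    assume "stage n x \<and> (i = 0 \<longrightarrow> x = ?init)"
    moreover obtain s g t g' G where x: "x = (s, g, t, g', G)" by (cases x)
    ultimately obtain u g'' H where "stage n (t, g', u, g'', H)" "poly_span n {..<u} H = syz n {..<t} G"
      using stage_next by blast
    then show "\<exists>y. (stage n y \<and> (Suc i = 0 \<longrightarrow> y = ?init)) \<and> ?next x y"
      by (intro exI[of _ "(t, g', u, g'', H)"]) (simp add: x)
  qed
  then obtain f where "\<forall>i. (stage n (f i) \<and> (i = 0 \<longrightarrow> f i = ?init)) \<and> ?next (f i) (f (Suc i))" ..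
  then have f: "\<And>i. stage n (f i)" "f 0 = ?init" "\<And>i. ?next (f i) (f (Suc i))"
    by simp_all
  define r where "r i = fst (f i)" for i
  define dg where "dg i = fst (snd (f i))" for i
  define t where "t i = fst (snd (snd (f i)))" for i
  define g' where "g' i = fst (snd (snd (snd (f i))))" for i
  define G where "G i = snd (snd (snd (snd (f i))))" for i
  \<comment> \<open>Stage \<open>i\<close> holds the map from \<open>F_(i+1)\<close> to
    \<open>F_i\<close>, which has the number \<open>Suc i\<close> in a resolution; rows and columns
    are exchanged.\<close>
  define d where "d i j k = G (i - 1) k j" for i j k
  have f_eq: "f i = (r i, dg i, t i, g' i, G i)" for i
    by (simp add: r_def dg_def t_def g'_def G_def)
  have t: "t i = r (Suc i)" and g': "g' i = dg (Suc i)"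
    and ex: "poly_span n {..<r (Suc (Suc i))} (G (Suc i)) = syz n {..<r (Suc i)} (G i)" for i
  proof -
    have "r (Suc i) = t i \<and> dg (Suc i) = g' i \<and> poly_span n {..<t (Suc i)} (G (Suc i)) = syz n {..<t i} (G i)" for i
      using f(3)[of i] unfolding f_eq by simp
    then show "t i = r (Suc i)" "g' i = dg (Suc i)"
      "poly_span n {..<r (Suc (Suc i))} (G (Suc i)) = syz n {..<r (Suc i)} (G i)" by metis+
  qed
  have init: "r 0 = 1" "dg 0 0 = 0" "r 1 = s" "G 0 = A"
    using f(2) t[of 0] by (simp_all add: f_eq)
  have st: "\<And>i j. j < r i \<Longrightarrow> Poly_Mapping.keys (dg i j) \<subseteq> {1..n}"
    "\<And>i. homogeneous (dg i) (dg (Suc i)) {..<r (Suc i)} (G i)"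
    "\<And>i j k. k < r (Suc i) \<Longrightarrow> coeff (G i k j) 0 = 0"
    "\<And>i j k. k < r (Suc i) \<Longrightarrow> r i \<le> j \<Longrightarrow> G i k j = 0"
    using f(1) unfolding f_eq t g' stage_def by auto
  have cols: "cols (r i) (d (Suc i)) k = G i k" if "k < r (Suc i)" for i k
    using st(4)[OF that] by (auto simp: cols_def d_def fun_eq_iff)
  have "minimal_free_resolution n ((\<lambda>v. v 0) ` poly_span n {..<s} A) r dg d"
    unfolding minimal_free_resolution_def multigraded_free_resolution_def
  proof (intro conjI allI impI ballI)
    fix i j k assume jk: "j < r i" "k < r (Suc i)"
    show "d (Suc i) j k \<in> poly_ring n"
      using homogeneous_poly_ring[OF st(2)[of i], of k n j] st(1)[of k "Suc i"] jk(2) by (simp add: d_def)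
    show "m + dg i j = dg (Suc i) k" if "m \<in> Poly_Mapping.keys (d (Suc i) j k)" for m
      using st(2)[of i] jk that by (auto simp: homogeneous_def d_def)
    show "coeff (d (Suc i) j k) 0 = 0" using st(3) jk(2) by (simp add: d_def)
  next
    have "(\<lambda>v. mat_map (r 0) (r 1) (d 1) v 0) ` free_module n (r 1)
        = (\<lambda>v. v 0) ` poly_span n {..<r 1} (cols (r 0) (d 1))"
      unfolding mat_map_image[symmetric] image_image ..
    also have "poly_span n {..<r 1} (cols (r 0) (d 1)) = poly_span n {..<s} A"
      using poly_span_cong[of "{..<r 1}" "cols (r 0) (d 1)" "G 0" n] cols[of _ 0] init by simp
    finally show "(\<lambda>v. mat_map (r 0) (r 1) (d 1) v 0) ` free_module n (r 1)
        = (\<lambda>v. v 0) ` poly_span n {..<s} A" .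
  next
    fix i
    have "syz n {..<r (Suc i)} (cols (r i) (d (Suc i))) = syz n {..<r (Suc i)} (G i)"
      by (rule syz_cong) (simp add: cols)
    also have "\<dots> = poly_span n {..<r (Suc (Suc i))} (cols (r (Suc i)) (d (Suc (Suc i))))"
      unfolding ex[symmetric] by (rule poly_span_cong) (simp add: cols)
    finally show "{v \<in> free_module n (r (Suc i)). mat_map (r i) (r (Suc i)) (d (Suc i)) v = (\<lambda>_. 0)}
        = mat_map (r (Suc i)) (r (Suc (Suc i))) (d (Suc (Suc i))) ` free_module n (r (Suc (Suc i)))"
      unfolding mat_map_kernel mat_map_image .
  qed (use init st(1) in auto)
  then show ?thesis by blast
qed

text \<open>Permuting generators and multiplying them by nonzero scalars changes the syzygies only
  by a permutation and rescaling of coordinates, so generators of the syzygies carry over with the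
  same index set \<open>P\<close>. This relates the first differential of any minimal resolution to
  the block monomials.\<close>

lemma syz_generators_transfer:
  fixes A :: "'j \<Rightarrow> 'i \<Rightarrow> 'k::field mpoly"
  assumes P: "finite P" and \<tau>: "bij_betw \<tau> J J'"
    and A': "\<And>j. j \<in> J \<Longrightarrow> \<exists>x. x \<noteq> 0 \<and> A' (\<tau> j) = (\<lambda>i. mon 0 x * A j i)"
    and eq: "poly_span n P G = syz n J' A'"
  shows "\<exists>G'. poly_span n P G' = syz n J A"
proof -
  obtain x where x: "\<And>j. j \<in> J \<Longrightarrow> x j \<noteq> 0" "\<And>j i. j \<in> J \<Longrightarrow> A' (\<tau> j) i = mon 0 (x j) * A j i"
    using A' by metis
  have \<tau>J: "\<tau> j \<in> J'" if "j \<in> J" for j using \<tau> that by (auto simp: bij_betw_def)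
  have sum: "(\<Sum>j\<in>J'. c j * A' j i) = (\<Sum>j\<in>J. mon 0 (x j) * c (\<tau> j) * A j i)" for c i
    using sum.reindex_bij_betw[OF \<tau>, of "\<lambda>j. c j * A' j i"] x(2) by (simp add: mult_ac cong: sum.cong)
  define G' where "G' p j = (if j \<in> J then mon 0 (x j) * G p (\<tau> j) else 0)" for p j
  have "poly_span n P G' = syz n J A"
  proof
    show "poly_span n P G' \<subseteq> syz n J A"
    proof (rule poly_span_subset_syz, rule syzI)
      fix p assume "p \<in> P"
      then have G: "G p \<in> syz n J' A'" using poly_span_base[OF P, of p G n] eq by simp
      show "G' p j \<in> poly_ring n" for j
        using syzD(1)[OF G] by (auto simp: G'_def intro!: poly_ring_mult)
      show "(\<Sum>j\<in>J. G' p j * A j i) = 0" for i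
        using syzD(3)[OF G, of i] unfolding sum by (simp add: G'_def cong: sum.cong)
    qed (simp add: G'_def)
    show "syz n J A \<subseteq> poly_span n P G'"
    proof
      fix v assume v: "v \<in> syz n J A"
      define v' where "v' j' = (if j' \<in> J' then
        (let j = inv_into J \<tau> j' in mon 0 (inverse (x j)) * v j) else 0)" for j'
      have v': "v' (\<tau> j) = mon 0 (inverse (x j)) * v j" if "j \<in> J" for j
        using \<tau> that \<tau>J by (simp add: v'_def bij_betw_inv_into_left)
      have xv': "mon 0 (x j) * v' (\<tau> j) = v j" if "j \<in> J" for j
        using x(1)[OF that] by (simp add: v' that mult_single flip: mult.assoc)
      have "v' \<in> syz n J' A'"
      proof (rule syzI)
        fix j show "v' j \<in> poly_ring n"
          using syzD(1)[OF v] by (auto simp: v'_def Let_def intro!: poly_ring_mult)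
      next
        fix i
        have "(\<Sum>j\<in>J'. v' j * A' j i) = (\<Sum>j\<in>J. v j * A j i)"
          unfolding sum by (simp add: xv' cong: sum.cong)
        then show "(\<Sum>j\<in>J'. v' j * A' j i) = 0" by (simp add: syzD(3)[OF v])
      qed (simp add: v'_def)
      then obtain c where c: "\<And>p. p \<in> P \<Longrightarrow> c p \<in> poly_ring n" "\<And>j. v' j = (\<Sum>p\<in>P. c p * G p j)"
        unfolding eq[symmetric] by (elim poly_spanE) blast
      have "v j = (\<Sum>p\<in>P. c p * G' p j)" for j
      proof (cases "j \<in> J")
        case True
        then have "v j = mon 0 (x j) * (\<Sum>p\<in>P. c p * G p (\<tau> j))" using xv' c(2) by metis
        then show ?thesis using True by (simp add: G'_def sum_distrib_left mult.left_commute)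
      next
        case False
        then show ?thesis using syzD(2)[OF v] by (simp add: G'_def)
      qed
      then show "v \<in> poly_span n P G'" using c(1) by (intro poly_spanI[of _ c]) auto
    qed
  qed
  then show ?thesis by blast
qed

subsection \<open>Cover-free triple families\<close>

text \<open>The 2-cover-free families of extremal set theory. The case \<open>a = b\<close> says
  that no member properly contains another.\<close>

definition cover_free :: "'a set set \<Rightarrow> bool" where
  "cover_free F \<longleftrightarrow> (\<forall>a\<in>F. \<forall>b\<in>F. \<forall>c\<in>F. c \<subseteq> a \<union> b \<longrightarrow> c = a \<or> c = b)"

definition pairs :: "'a set \<Rightarrow> 'a set set" where
  "pairs X = {T. T \<subseteq> X \<and> card T = 2}"

lemma card_pairs: "finite X \<Longrightarrow> card (pairs X) = card X choose 2"
  unfolding pairs_def by (rule n_subsets)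

lemma two_le_card_obtain_pair:
  assumes "2 \<le> card X" obtains T where "T \<in> pairs X"
  using assms obtain_subset_with_card_n[of 2 X] by (auto simp: pairs_def)

lemma card_Union_pairs:
  assumes fin: "finite V" and F: "\<And>b. b \<in> F \<Longrightarrow> b \<subseteq> V \<and> card b = 3"
    and lin: "\<And>b c. b \<in> F \<Longrightarrow> c \<in> F \<Longrightarrow> b \<noteq> c \<Longrightarrow> card (b \<inter> c) \<le> 1"
  shows "card (\<Union>b\<in>F. pairs b) = 3 * card F"
proof -
  have "finite F" using fin F by (meson Pow_iff finite_Pow_iff finite_subset subsetI)
  moreover have "finite (pairs b)" if "b \<in> F" for b
    using F[OF that] fin finite_subset[of "pairs b" "Pow V"] by (auto simp: pairs_def)
  moreover have "pairs b \<inter> pairs c = {}" if "b \<in> F" "c \<in> F" "b \<noteq> c" for b c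
  proof (rule ccontr)
    assume "pairs b \<inter> pairs c \<noteq> {}"
    then obtain T where T: "T \<subseteq> b \<inter> c" "card T = 2" by (auto simp: pairs_def)
    have "finite (b \<inter> c)" using F[OF that(1)] fin finite_subset by blast
    then show False using lin[OF that] card_mono[OF _ T(1)] T(2) by simp
  qed
  ultimately have "card (\<Union>b\<in>F. pairs b) = (\<Sum>b\<in>F. card (pairs b))"
    by (intro card_UN_disjoint) auto
  also have "\<dots> = (\<Sum>b\<in>F. 3)"
  proof (rule sum.cong)
    fix b assume "b \<in> F"
    then have "finite b" "card b = 3" using F fin finite_subset by blast+
    then show "card (pairs b) = 3" by (simp add: card_pairs choose_two)
  qed simp
  finally show ?thesis by simp
qed

text \<open>If \<open>b\<close> had two vertices in \<open>c\<close>, its remaining vertex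
  \<open>z\<close> would lie in some other block \<open>d\<close>, and \<open>c\<close> and
  \<open>d\<close> together would cover \<open>b\<close>.\<close>

lemma card_inter_le_1_of_cover_free:
  assumes cf: "cover_free F" and fin: "finite b" "finite c" "card b = 3" "card c = 3"
    and bc: "b \<in> F" "c \<in> F" "b \<noteq> c"
    and shared: "\<And>z. z \<in> b \<Longrightarrow> \<exists>d\<in>F. z \<in> d \<and> d \<noteq> b"
  shows "card (b \<inter> c) \<le> 1"
proof (rule ccontr)
  assume "\<not> card (b \<inter> c) \<le> 1"
  moreover have "card (b - c) = 3 - card (b \<inter> c)"
    using fin by (simp add: card_Diff_subset_Int)
  moreover have "card (b - c) \<noteq> 0"
    using fin bc(3) card_subset_eq[of c b] by auto
  ultimately have "card (b - c) = 1" by simp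
  then obtain z where z: "b - c = {z}" by (auto simp: card_1_singleton_iff)
  then obtain d where d: "d \<in> F" "z \<in> d" "d \<noteq> b" using shared[of z] by blast
  have "b \<subseteq> c \<union> d" using z d(2) by auto
  then show False using cf bc d by (auto simp: cover_free_def)
qed

lemma cover_free_subset: "cover_free F \<Longrightarrow> F' \<subseteq> F \<Longrightarrow> cover_free F'"
  unfolding cover_free_def by blast

text \<open>Each block either has a vertex of its own, which is then deleted, or meets every other block
  in at most one vertex.\<close>

lemma cover_free_triples_card:
  assumes "finite V" and "\<And>b. b \<in> F \<Longrightarrow> b \<subseteq> V \<and> card b = 3" and "cover_free F"
  shows "6 * card F \<le> card V * (card V - 1)"
  using assms
proof (induction "card V" arbitrary: V F rule: less_induct)
  case less
  note fin = less.prems(1) and F = less.prems(2) and cf = less.prems(3)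
  have finF: "finite F" using fin F by (meson Pow_iff finite_Pow_iff finite_subset subsetI)
  have finb: "finite b" if "b \<in> F" for b using F[OF that] fin finite_subset by blast
  show ?case
  proof (cases "\<exists>b\<in>F. \<exists>z\<in>b. \<forall>d\<in>F. z \<in> d \<longrightarrow> d = b")
    case True
    then obtain b z where b: "b \<in> F" "z \<in> b" "\<And>d. d \<in> F \<Longrightarrow> z \<in> d \<Longrightarrow> d = b" by blast
    have z: "z \<in> V" using b F by blast
    have V3: "3 \<le> card V" using F[OF b(1)] card_mono[OF fin, of b] by simp
    show ?thesis
    \<comment> \<open>On 3 vertices a deletion lowers the bound by only 4, less than the 6 that the
      lost block counts; but only one block fits there.\<close>
    proof (cases "card V = 3")
      case True
      have "F \<subseteq> {V}"
      proof
        fix c assume "c \<in> F"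
        then have "c = V" using F[of c] True card_subset_eq[OF fin, of c] by simp
        then show "c \<in> {V}" by simp
      qed
      then have "card F \<le> 1" using card_mono[of "{V}" F] by simp
      then show ?thesis using True by simp
    next
      case False
      have "6 * card (F - {b}) \<le> card (V - {z}) * (card (V - {z}) - 1)"
      proof (rule less.hyps)
        show "card (V - {z}) < card V" using card_Diff1_less[OF fin z] .
        show "c \<subseteq> V - {z} \<and> card c = 3" if "c \<in> F - {b}" for c
          using that F[of c] b(3) by blast
        show "cover_free (F - {b})" using cover_free_subset[OF cf] by blast
      qed (use fin in auto)
      moreover define m where "m = card V - 4"
      then have "card V = m + 4" using V3 False by simp
      ultimately show ?thesis
        using \<open>card V = m + 4\<close> card.remove[OF finF b(1)] z fin by (simp add: algebra_simps)
    qed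
  next
    case False
    have "card (\<Union>b\<in>F. pairs b) = 3 * card F"
    proof (rule card_Union_pairs[OF fin F])
      fix b c assume bc: "b \<in> F" "c \<in> F" "b \<noteq> c"
      show "card (b \<inter> c) \<le> 1"
      proof (rule card_inter_le_1_of_cover_free[OF cf _ _ _ _ bc])
        show "\<exists>d\<in>F. z \<in> d \<and> d \<noteq> b" if "z \<in> b" for z using that False bc(1) by blast
      qed (use bc F finb in auto)
    qed
    moreover have "card (\<Union>b\<in>F. pairs b) \<le> card (pairs V)"
    proof (rule card_mono)
      show "finite (pairs V)" using fin by (simp add: pairs_def)
    qed (use F in \<open>auto simp: pairs_def\<close>)
    ultimately have "3 * card F \<le> card V * (card V - 1) div 2"
      using card_pairs[OF fin] by (simp add: choose_two)
    then show ?thesis by linarith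
  qed
qed

text \<open>In a Steiner triple system two blocks share at most one vertex, so two blocks cover at
  most two vertices of a third. Conversely, equality in \<open>cover_free_triples_card\<close>
  leaves no block with a private vertex; then blocks again share at most one vertex, and by their
  number their pairs exhaust all pairs.\<close>

lemma STS_iff_cover_free:
  assumes n: "n > 4" and B: "B \<subseteq> blocks 3 n"
  shows "STS n B \<longleftrightarrow> cover_free B \<and> 6 * card B = n * (n - 1)"
proof -
  have F: "b \<subseteq> {1..n} \<and> card b = 3" if "b \<in> B" for b using B that by (auto simp: blocks_def)
  have finb: "finite b" if "b \<in> B" for b using F[OF that] finite_subset by blast
  have finB: "finite B" using F by (meson Pow_iff finite_Pow_iff finite_subset subsetI finite_atLeastAtMost)
  have STS: "STS n B \<longleftrightarrow> (\<forall>T\<in>pairs {1..n}. \<exists>!b. b \<in> B \<and> T \<subseteq> b)"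
    using B unfolding STS_def steiner_system_def by (simp add: pairs_def blocks_def)
  have cardV: "2 * card (pairs {1..n}) = n * (n - 1)"
  proof -
    have "even (n * (n - 1))" by (cases "even n") auto
    then show ?thesis by (simp add: card_pairs choose_two)
  qed
  have finV: "finite (pairs {1..n})" by (simp add: pairs_def)
  have sub: "(\<Union>b\<in>B. pairs b) \<subseteq> pairs {1..n}" using F by (auto simp: pairs_def)
  show ?thesis
  proof
    assume "STS n B"
    note S = this[unfolded STS]
    have lin: "card (b \<inter> c) \<le> 1" if bc: "b \<in> B" "c \<in> B" "b \<noteq> c" for b c
    proof (rule ccontr)
      assume "\<not> card (b \<inter> c) \<le> 1"
      then obtain T where T: "T \<in> pairs (b \<inter> c)" using two_le_card_obtain_pair[of "b \<inter> c"] by auto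
      then have "T \<in> pairs {1..n}" "T \<subseteq> b" "T \<subseteq> c" using F[OF bc(1)] by (auto simp: pairs_def)
      then show False using S bc by blast
    qed
    have "cover_free B"
      unfolding cover_free_def
    proof (intro ballI impI, rule ccontr)
      fix a b c assume abc: "a \<in> B" "b \<in> B" "c \<in> B" "c \<subseteq> a \<union> b" "\<not> (c = a \<or> c = b)"
      then have "c = (c \<inter> a) \<union> (c \<inter> b)" by blast
      then have "card c \<le> card (c \<inter> a) + card (c \<inter> b)" by (metis card_Un_le)
      then show False using lin[of c a] lin[of c b] abc F[of c] by fastforce
    qed
    moreover have "(\<Union>b\<in>B. pairs b) = pairs {1..n}"
      using S sub by (fastforce simp: pairs_def)
    ultimately show "cover_free B \<and> 6 * card B = n * (n - 1)"
      using card_Union_pairs[of "{1..n}" B, OF _ F lin] cardV by simp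
  next
    assume "cover_free B \<and> 6 * card B = n * (n - 1)"
    then have cf: "cover_free B" and card: "6 * card B = n * (n - 1)" by auto
    \<comment> \<open>Without \<open>b\<close> and a private vertex \<open>z\<close> there remain
      \<open>card B - 1\<close> blocks on \<open>n - 1\<close> vertices; the bound for these gives
      \<open>2 * (n - 1) <= 6\<close>, against \<open>n > 4\<close>.\<close>
    have shared: "\<exists>d\<in>B. z \<in> d \<and> d \<noteq> b" if b: "b \<in> B" "z \<in> b" for b z
    proof (rule ccontr)
      assume z: "\<not> (\<exists>d\<in>B. z \<in> d \<and> d \<noteq> b)"
      have zn: "z \<in> {1..n}" using F b by blast
      have "6 * card (B - {b}) \<le> card ({1..n} - {z}) * (card ({1..n} - {z}) - 1)"
      proof (rule cover_free_triples_card)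
        show "c \<subseteq> {1..n} - {z} \<and> card c = 3" if "c \<in> B - {b}" for c
          using that F[of c] z by blast
        show "cover_free (B - {b})" using cover_free_subset[OF cf] by blast
      qed simp
      moreover have "card ({1..n} - {z}) = n - 1" using zn by simp
      moreover define m where "m = n - 5"
      then have "n = m + 5" using n by simp
      ultimately show False
        using \<open>n = m + 5\<close> card card.remove[OF finB b(1)] by (simp add: algebra_simps)
    qed
    have lin: "card (b \<inter> c) \<le> 1" if bc: "b \<in> B" "c \<in> B" "b \<noteq> c" for b c
      by (rule card_inter_le_1_of_cover_free[OF cf _ _ _ _ bc]) (use bc F finb shared in auto)
    have "card (\<Union>b\<in>B. pairs b) = card (pairs {1..n})"
      using card_Union_pairs[of "{1..n}" B, OF _ F lin] card cardV by simp
    then have all: "(\<Union>b\<in>B. pairs b) = pairs {1..n}"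
      using card_subset_eq[OF finV sub] by simp
    show "STS n B"
      unfolding STS
    proof (intro ballI ex_ex1I)
      fix T assume "T \<in> pairs {1..n}"
      then show "\<exists>b. b \<in> B \<and> T \<subseteq> b" unfolding all[symmetric] by (auto simp: pairs_def)
    next
      fix T b c assume T: "T \<in> pairs {1..n}" and b: "b \<in> B \<and> T \<subseteq> b" and c: "c \<in> B \<and> T \<subseteq> c"
      show "b = c"
      proof (rule ccontr)
        assume "b \<noteq> c"
        then have "card (b \<inter> c) \<le> 1" using lin b c by blast
        moreover have "card T \<le> card (b \<inter> c)" using b c finb by (intro card_mono) auto
        ultimately show False using T by (simp add: pairs_def)
      qed
    qed
  qed
qed

subsection \<open>The block ideal\<close>

definition block_expo :: "nat set \<Rightarrow> expo" where
  "block_expo b = (\<Sum>i\<in>b. mon i 1)"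

lemma block_monomial_eq: "block_monomial b = mon (block_expo b) 1"
  by (simp add: block_monomial_def block_expo_def)

lemma lookup_block_expo: "finite b \<Longrightarrow> coeff (block_expo b) i = (if i \<in> b then 1 else 0)"
  by (simp add: block_expo_def lookup_sum lookup_single when_def)

lemma keys_block_expo: "finite b \<Longrightarrow> Poly_Mapping.keys (block_expo b) = b"
  by (auto simp: in_keys_iff lookup_block_expo split: if_splits)

lemma edvd_block_expo: "finite b \<Longrightarrow> edvd (block_expo b) m \<longleftrightarrow> b \<subseteq> Poly_Mapping.keys m"
  by (auto simp: edvd_def in_keys_iff lookup_block_expo)

text \<open>The blocks are numbered because resolutions index basis elements by natural numbers.
  Equal size makes the blocks incomparable, and positive size keeps constants out of the
  generators.\<close>

locale block_family =
  fixes n k s :: nat and \<beta> :: "nat \<Rightarrow> nat set"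
  assumes inj: "inj_on \<beta> {..<s}"
    and vertices: "\<And>j. j < s \<Longrightarrow> \<beta> j \<subseteq> {1..n}"
    and size: "\<And>j. j < s \<Longrightarrow> card (\<beta> j) = k"
    and size_pos: "0 < k"
begin

abbreviation E :: "nat \<Rightarrow> expo" where
  "E j \<equiv> block_expo (\<beta> j)"

definition gen :: "nat \<Rightarrow> nat \<Rightarrow> 'k::field mpoly" where
  "gen j i = (if i = 0 then block_monomial (\<beta> j) else 0)"

lemma finite_block: "j < s \<Longrightarrow> finite (\<beta> j)"
  using vertices finite_subset by blast

lemma keys_E: "j < s \<Longrightarrow> Poly_Mapping.keys (E j) = \<beta> j"
  by (simp add: keys_block_expo finite_block)

lemma edvd_E: "j < s \<Longrightarrow> edvd (E j) m \<longleftrightarrow> \<beta> j \<subseteq> Poly_Mapping.keys m"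
  by (simp add: edvd_block_expo finite_block)

lemma block_eqI: "i < s \<Longrightarrow> j < s \<Longrightarrow> \<beta> i \<subseteq> \<beta> j \<Longrightarrow> i = j"
  using card_subset_eq[of "\<beta> j" "\<beta> i"] finite_block size inj by (metis inj_onD lessThan_iff)

lemma edvd_E_E: "i < s \<Longrightarrow> j < s \<Longrightarrow> edvd (E i) (E j) \<longleftrightarrow> i = j"
  using block_eqI by (auto simp: edvd_E keys_E)

lemma gen_homogeneous: "homogeneous (\<lambda>_. 0) E {..<s} gen"
  by (auto simp: homogeneous_def gen_def block_monomial_eq)

text \<open>In the coefficient of \<open>E j\<close> only the summand of \<open>j\<close> survives,
  since no other generator divides the \<open>j\<close>-th; it contributes the constant term of
  \<open>c j\<close>.\<close>

lemma gen_no_unit_syz: "no_unit_syz n {..<s} (gen :: nat \<Rightarrow> nat \<Rightarrow> 'k::field mpoly)"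
  unfolding no_unit_syz_def
proof (intro ballI allI)
  fix c :: "nat \<Rightarrow> 'k mpoly" and j assume c: "c \<in> syz n {..<s} gen"
  show "coeff (c j) 0 = 0"
  proof (cases "j < s")
    case True
    have "coeff (\<Sum>i<s. c i * gen i 0) (E j) = (\<Sum>i<s. if i = j then coeff (c j) 0 else 0)"
      unfolding lookup_sum using True
      by (intro sum.cong) (auto simp: gen_def block_monomial_eq coeff_mult_single edvd_E_E)
    then show ?thesis using True syzD(3)[OF c, of 0] by simp
  qed (use syzD(2)[OF c] in auto)
qed

lemma block_ideal_eq:
  "block_ideal n (\<beta> ` {..<s}) = (\<lambda>v. v 0) ` poly_span n {..<s} (gen :: nat \<Rightarrow> nat \<Rightarrow> 'k::field mpoly)"
proof -
  have bij: "bij_betw \<beta> {..<s} (\<beta> ` {..<s})" using inj by (simp add: bij_betw_def)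
  have eval: "(\<lambda>v. v i) ` poly_span n J A = {\<Sum>j\<in>J. c j * A j i | c. \<forall>j\<in>J. c j \<in> poly_ring n}"
    for i :: 'i and J :: "'j set" and A :: "'j \<Rightarrow> 'i \<Rightarrow> 'k mpoly"
    unfolding poly_span_def setcompr_eq_image image_image ..
  have "block_ideal n (\<beta> ` {..<s})
      = (\<lambda>v. v 0) ` poly_span n (\<beta> ` {..<s}) (\<lambda>b i. if i = (0::nat) then block_monomial b else 0 :: 'k mpoly)"
    unfolding block_ideal_def eval by simp
  also have "\<dots> = (\<lambda>v. v 0) ` poly_span n {..<s} gen"
    unfolding gen_def by (simp only: poly_span_reindex[OF bij, symmetric])
  finally show ?thesis .
qed

lemma resolution_exists:
  "\<exists>r dg d. minimal_free_resolution n (block_ideal n (\<beta> ` {..<s}) :: 'k::field mpoly set) r dg d"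
  unfolding block_ideal_eq
proof (rule minimal_free_resolution_exists)
  have "E j \<noteq> 0" if "j < s" for j
    using keys_E[OF that] size[OF that] size_pos by force
  then show "stage n (1, \<lambda>_. 0, s, E, gen :: nat \<Rightarrow> nat \<Rightarrow> 'k mpoly)"
    using gen_homogeneous gen_no_unit_syz vertices
    by (auto simp: stage_def keys_E gen_def block_monomial_eq lookup_single when_def)
qed

section \<open>The first two ranks of a minimal resolution\<close>

lemma edvd_of_mem_block_ideal:
  assumes "p \<in> (block_ideal n (\<beta> ` {..<s}) :: 'k::field mpoly set)" and "u \<in> Poly_Mapping.keys p"
  shows "\<exists>j<s. edvd (E j) u"
proof -
  obtain v where v: "v \<in> poly_span n {..<s} gen" "p = v 0"
    using assms(1) unfolding block_ideal_eq by (elim imageE)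
  then obtain c where "p = (\<Sum>j<s. c j * gen j 0)" by (elim poly_spanE) blast
  then have "(\<Sum>j<s. coeff (c j * gen j 0) u) \<noteq> 0" using assms(2) by (simp add: in_keys_iff lookup_sum)
  then have "\<exists>j\<in>{..<s}. coeff (c j * gen j 0) u \<noteq> 0" by (meson sum.not_neutral_contains_not_neutral)
  then obtain j where "j < s" "coeff (c j * gen j 0) u \<noteq> 0" by blast
  then show ?thesis by (auto simp: gen_def block_monomial_eq coeff_mult_single split: if_splits)
qed

text \<open>The degrees of the columns are forced. A column that contributes to the monomial
  \<open>E j\<close> has a degree dividing \<open>E j\<close>; as the column lies in the ideal, its
  degree is divisible by some \<open>E i\<close>. Blocks being incomparable, \<open>i = j\<close>
  and the degree is \<open>E j\<close>. Equal cardinalities then make the injection \<tau> a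
  bijection.\<close>

lemma resolution_first_step:
  fixes d :: "nat \<Rightarrow> nat \<Rightarrow> nat \<Rightarrow> 'k::field mpoly"
  assumes min: "minimal_free_resolution n (block_ideal n (\<beta> ` {..<s})) r dg d"
  shows "r 1 = s" and "\<exists>\<tau>. bij_betw \<tau> {..<s} {..<r 1} \<and>
    (\<forall>j<s. \<exists>x. x \<noteq> 0 \<and> cols 1 (d 1) (\<tau> j) = (\<lambda>i. mon 0 x * gen j i))"
proof -
  let ?C = "cols 1 (d 1)" and ?g = "gen :: nat \<Rightarrow> nat \<Rightarrow> 'k mpoly"
  have res: "multigraded_free_resolution n (block_ideal n (\<beta> ` {..<s})) r dg d"
    using min by (simp add: minimal_free_resolution_def)
  have r0: "r 0 = 1" and dg0: "dg 0 0 = 0" using res by (auto simp: multigraded_free_resolution_def)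
  have zero: "v i = 0" if "v \<in> poly_span n {..<r 1} ?C \<or> v \<in> poly_span n {..<s} ?g" "i \<noteq> 0" for v i
    using that by (auto elim!: poly_spanE simp: cols_def gen_def)
  have eq: "(\<lambda>v. v 0) ` poly_span n {..<r 1} ?C = (\<lambda>v. v 0) ` poly_span n {..<s} ?g"
    using resolution_image[OF res] unfolding block_ideal_eq .
  have ext: "v = w" if "v 0 = w 0" "v \<in> poly_span n {..<r 1} ?C" "w \<in> poly_span n {..<s} ?g" for v w
  proof
    fix i show "v i = w i" using that zero[of v i] zero[of w i] by (cases "i = 0") auto
  qed
  have span: "poly_span n {..<r 1} ?C = poly_span n {..<s} ?g"
  proof (intro subset_antisym subsetI)
    fix v assume v: "v \<in> poly_span n {..<r 1} ?C"
    then have "v 0 \<in> (\<lambda>v. v 0) ` poly_span n {..<s} ?g" unfolding eq[symmetric] by (rule imageI)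
    then obtain w where "w \<in> poly_span n {..<s} ?g" "v 0 = w 0" by (rule imageE)
    then show "v \<in> poly_span n {..<s} ?g" using ext v by metis
  next
    fix w assume w: "w \<in> poly_span n {..<s} ?g"
    then have "w 0 \<in> (\<lambda>v. v 0) ` poly_span n {..<r 1} ?C" unfolding eq by (rule imageI)
    then obtain v where "v \<in> poly_span n {..<r 1} ?C" "w 0 = v 0" by (rule imageE)
    then show "w \<in> poly_span n {..<r 1} ?C" using ext w by metis
  qed
  have "r 1 \<le> s"
    using card_le_of_no_unit_syz[OF _ _ span] minimal_resolution_no_unit_syz[OF min, of 0] r0 by simp
  moreover have "s \<le> r 1"
    using card_le_of_no_unit_syz[OF _ _ span[symmetric] gen_no_unit_syz] by simp
  ultimately show r1: "r 1 = s" by simp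
  have keysC: "u = dg 1 l" if "u \<in> Poly_Mapping.keys (?C l 0)" "l < r 1" for u l
    using resolution_homogeneous[OF res, of 0] that r0 dg0 by (force simp: homogeneous_def)
  have "\<exists>l<r 1. ?C l 0 \<noteq> 0 \<and> dg 1 l = E j" if j: "j < s" for j
  proof -
    have "?g j \<in> poly_span n {..<r 1} ?C" unfolding span using j by (intro poly_span_base) auto
    then obtain c where c: "?g j 0 = (\<Sum>l<r 1. c l * ?C l 0)" by (elim poly_spanE) blast
    have "coeff (gen j 0 :: 'k mpoly) (E j) = 1" by (simp add: gen_def block_monomial_eq)
    then have "(\<Sum>l<r 1. coeff (c l * ?C l 0) (E j)) \<noteq> 0" unfolding c lookup_sum by simp
    then have "\<exists>l\<in>{..<r 1}. coeff (c l * ?C l 0) (E j) \<noteq> 0" by (meson sum.not_neutral_contains_not_neutral)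
    then obtain l where l: "l < r 1" "coeff (c l * ?C l 0) (E j) \<noteq> 0" by blast
    then have nz: "?C l 0 \<noteq> 0" by auto
    then obtain u where "u \<in> Poly_Mapping.keys (?C l 0)" by (metis keys_eq_empty ex_in_conv)
    then have key: "dg 1 l \<in> Poly_Mapping.keys (?C l 0)" using keysC l(1) by metis
    have "Poly_Mapping.keys (?C l 0) \<subseteq> {dg 1 l}" using keysC l(1) by blast
    then have "?C l 0 = mon (dg 1 l) (coeff (?C l 0) (dg 1 l))" by (rule single_keys_subset)
    then have dvd: "edvd (dg 1 l) (E j)" using l(2) coeff_mult_single by metis
    have "?C l 0 \<in> block_ideal n (\<beta> ` {..<s})"
      unfolding resolution_image[OF res, symmetric] using l(1) by (intro imageI poly_span_base) auto
    then obtain i where i: "i < s" "edvd (E i) (dg 1 l)" using edvd_of_mem_block_ideal key by blast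
    then have "i = j" using edvd_E_E[OF i(1) j] edvd_trans dvd by blast
    then show ?thesis using i dvd edvd_antisym nz l(1) by blast
  qed
  then obtain \<tau> where \<tau>: "\<And>j. j < s \<Longrightarrow> \<tau> j < r 1" "\<And>j. j < s \<Longrightarrow> ?C (\<tau> j) 0 \<noteq> 0"
    "\<And>j. j < s \<Longrightarrow> dg 1 (\<tau> j) = E j" by metis
  have "inj_on \<tau> {..<s}"
    using \<tau>(3) edvd_E_E edvd_refl by (intro inj_onI) (metis lessThan_iff)
  then have "\<tau> ` {..<s} = {..<s}" using \<tau>(1) r1 by (intro endo_inj_surj) auto
  then have "bij_betw \<tau> {..<s} {..<r 1}" using \<open>inj_on \<tau> {..<s}\<close> r1 by (simp add: bij_betw_def)
  moreover have "\<exists>x. x \<noteq> 0 \<and> ?C (\<tau> j) = (\<lambda>i. mon 0 x * gen j i)" if j: "j < s" for j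
  proof -
    have "Poly_Mapping.keys (?C (\<tau> j) 0) \<subseteq> {E j}" using keysC[of _ "\<tau> j"] \<tau> j by auto
    then have eq: "?C (\<tau> j) 0 = mon (E j) (coeff (?C (\<tau> j) 0) (E j))" by (rule single_keys_subset)
    then have nz: "coeff (?C (\<tau> j) 0) (E j) \<noteq> 0" using \<tau>(2)[OF j] by force
    have "?C (\<tau> j) i = mon 0 (coeff (?C (\<tau> j) 0) (E j)) * gen j i" for i
      by (cases "i = 0") (use eq in \<open>simp_all add: gen_def block_monomial_eq mult_single cols_def\<close>)
    with nz show ?thesis by blast
  qed
  ultimately show "\<exists>\<tau>. bij_betw \<tau> {..<s} {..<r 1} \<and>
    (\<forall>j<s. \<exists>x. x \<noteq> 0 \<and> ?C (\<tau> j) = (\<lambda>i. mon 0 x * gen j i))" by blast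
qed

text \<open>Together the claims say that \<open>r 2\<close> is the least number of generators of the
  syzygies of the block monomials, for every minimal resolution. Generators are carried over along
  \<tau> and its inverse.\<close>

lemma
  fixes d :: "nat \<Rightarrow> nat \<Rightarrow> nat \<Rightarrow> 'k::field mpoly"
  assumes min: "minimal_free_resolution n (block_ideal n (\<beta> ` {..<s})) r dg d"
  shows resolution_second_step_generators:
      "\<exists>G. poly_span n {..<r 2} G = syz n {..<s} (gen :: nat \<Rightarrow> nat \<Rightarrow> 'k mpoly)"
    and resolution_second_step_minimal: "\<And>(P :: 'p set) G. finite P
      \<Longrightarrow> poly_span n P G = syz n {..<s} (gen :: nat \<Rightarrow> nat \<Rightarrow> 'k mpoly) \<Longrightarrow> r 2 \<le> card P"
proof -
  let ?C = "cols 1 (d 1)"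
  have res: "multigraded_free_resolution n (block_ideal n (\<beta> ` {..<s})) r dg d"
    using min by (simp add: minimal_free_resolution_def)
  have r0: "r 0 = 1" using res by (auto simp: multigraded_free_resolution_def)
  obtain \<tau> where bij: "bij_betw \<tau> {..<s} {..<r 1}"
    and \<tau>: "\<And>j. j < s \<Longrightarrow> \<exists>x. x \<noteq> 0 \<and> ?C (\<tau> j) = (\<lambda>i. mon 0 x * gen j i)"
    using resolution_first_step(2)[OF min] by blast
  have syzC: "poly_span n {..<r 2} (cols (r 1) (d 2)) = syz n {..<r 1} ?C"
    using resolution_exact[OF res, of 0] r0 by (simp add: numeral_2_eq_2)
  show "\<exists>G. poly_span n {..<r 2} G = syz n {..<s} (gen :: nat \<Rightarrow> nat \<Rightarrow> 'k mpoly)"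
    using syz_generators_transfer[OF _ bij _ syzC] \<tau> by simp
  fix P :: "'p set" and G
  assume P: "finite P" and G: "poly_span n P G = syz n {..<s} (gen :: nat \<Rightarrow> nat \<Rightarrow> 'k mpoly)"
  let ?\<sigma> = "inv_into {..<s} \<tau>"
  have bij': "bij_betw ?\<sigma> {..<r 1} {..<s}" using bij by (rule bij_betw_inv_into)
  have "\<exists>x. x \<noteq> 0 \<and> gen (?\<sigma> l) = (\<lambda>i. mon 0 x * ?C l i)" if l: "l \<in> {..<r 1}" for l
  proof -
    have "?\<sigma> l < s" using bij' l by (auto simp: bij_betw_def)
    moreover have "\<tau> (?\<sigma> l) = l" using bij_betw_inv_into_right[OF bij] l by simp
    ultimately obtain x where x: "x \<noteq> 0" "?C l = (\<lambda>i. mon 0 x * gen (?\<sigma> l) i)" using \<tau> by metis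
    then have "gen (?\<sigma> l) i = mon 0 (inverse x) * ?C l i" for i
      by (simp add: mult_single flip: mult.assoc)
    then show ?thesis using x(1) by (intro exI[of _ "inverse x"]) auto
  qed
  from syz_generators_transfer[OF P bij' this G]
  obtain G' where "poly_span n P G' = syz n {..<r 1} ?C" by blast
  then have "poly_span n {..<r 2} (cols (r 1) (d 2)) = poly_span n P G'" using syzC by simp
  then show "r 2 \<le> card P"
    using card_le_of_no_unit_syz[OF _ P] minimal_resolution_no_unit_syz[OF min, of 1]
    by (fastforce simp: numeral_2_eq_2)
qed

lemma betti_1: "betti n (block_ideal n (\<beta> ` {..<s}) :: 'k::field mpoly set) 1 = s"
  unfolding betti_def
  using resolution_exists resolution_first_step(1) by (intro the_equality) blast+

text \<open>Each of two minimal resolutions yields a generating family of the same syzygy module,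
  whose size bounds the rank of the other; hence the definite description is well defined.\<close>

lemma betti_2:
  "\<exists>r dg d. minimal_free_resolution n (block_ideal n (\<beta> ` {..<s}) :: 'k::field mpoly set) r dg d
    \<and> betti n (block_ideal n (\<beta> ` {..<s}) :: 'k::field mpoly set) 2 = r 2"
proof -
  obtain r dg and d :: "nat \<Rightarrow> nat \<Rightarrow> nat \<Rightarrow> 'k mpoly"
    where res: "minimal_free_resolution n (block_ideal n (\<beta> ` {..<s})) r dg d"
    using resolution_exists by blast
  have le: "r 2 \<le> r' 2"
    if 1: "minimal_free_resolution n (block_ideal n (\<beta> ` {..<s})) r dg d"
      and 2: "minimal_free_resolution n (block_ideal n (\<beta> ` {..<s})) r' dg' d'"
    for r dg r' dg' and d d' :: "nat \<Rightarrow> nat \<Rightarrow> nat \<Rightarrow> 'k mpoly"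
    using resolution_second_step_generators[OF 2] resolution_second_step_minimal[OF 1, of "{..<r' 2}"]
    by auto
  have "betti n (block_ideal n (\<beta> ` {..<s}) :: 'k::field mpoly set) 2 = r 2"
    unfolding betti_def
  proof (rule the_equality)
    fix b assume "\<exists>r dg d. minimal_free_resolution n
      (block_ideal n (\<beta> ` {..<s}) :: 'k::field mpoly set) r dg d \<and> r 2 = b"
    then show "b = r 2" using le[OF res] le[OF _ res] le_antisym by metis
  qed (use res in blast)
  with res show ?thesis by blast
qed

subsection \<open>Pair syzygies\<close>

text \<open>For \<open>m\<close> divisible by both monomials this is the relation of degree
  \<open>m\<close> between the generators \<open>j\<close> and \<open>l\<close>. Allowing any common
  multiple instead of the least one makes these relations telescope.\<close>

definition diff :: "expo \<Rightarrow> nat \<Rightarrow> nat \<Rightarrow> nat \<Rightarrow> 'k::field mpoly" where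
  "diff m j l = (\<lambda>i. (if i = j then mon (m - E j) 1 else 0) - (if i = l then mon (m - E l) 1 else 0))"

text \<open>Up to sign, the columns of the second differential of the Taylor complex.\<close>

definition pair :: "nat \<times> nat \<Rightarrow> nat \<Rightarrow> 'k::field mpoly" where
  "pair = (\<lambda>(j, l). diff (elcm (E j) (E l)) j l)"

definition pair_indices :: "(nat \<times> nat) set" where
  "pair_indices = (SIGMA j:{..<s}. {..<j})"

lemma finite_pair_indices: "finite pair_indices"
  by (simp add: pair_indices_def)

lemma card_pair_indices: "card pair_indices = s choose 2"
proof -
  have "card (SIGMA j:{..<s}. {..<j}) = (\<Sum>j<s. j)" by simp
  also have "\<dots> = s choose 2"
    by (induction s) (simp_all add: numeral_2_eq_2)
  finally show ?thesis by (simp add: pair_indices_def)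
qed

lemma diff_poly_ring: "Poly_Mapping.keys m \<subseteq> {1..n} \<Longrightarrow> diff m j l i \<in> poly_ring n"
  using subset_trans[OF keys_diff_expo] unfolding diff_def
  by (intro poly_ring_diff) (simp_all add: poly_ring_single)

lemma diff_syz:
  assumes "j < s" "l < s" "edvd (E j) m" "edvd (E l) m" "Poly_Mapping.keys m \<subseteq> {1..n}"
  shows "diff m j l \<in> syz n {..<s} gen"
proof (rule syzI)
  fix i
  have "(\<Sum>j'<s. diff m j l j' * gen j' i)
      = (\<Sum>j'<s. if j' = j then mon (m - E j) 1 * gen j i else 0)
      - (\<Sum>j'<s. if j' = l then mon (m - E l) 1 * gen l i else 0)"
    unfolding sum_subtractf[symmetric] by (rule sum.cong) (auto simp: diff_def algebra_simps)
  also have "\<dots> = 0" using assms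
    by (simp add: gen_def block_monomial_eq mult_single edvd_diff_add)
  finally show "(\<Sum>j'<s. diff m j l j' * gen j' i) = 0" .
qed (use assms in \<open>auto simp: diff_poly_ring, auto simp: diff_def\<close>)

text \<open>The least common multiple divides \<open>m\<close>, so the relation in degree
  \<open>m\<close> is a monomial multiple of the pair syzygy, with a sign for the reversed order. An
  arbitrary \<open>R\<close> serves both the full set of pairs and the set with one pair
  removed.\<close>

lemma diff_in_span_pairs:
  assumes R: "finite R" and jl: "(j, l) \<in> R \<or> (l, j) \<in> R \<or> j = l"
    and dvd: "edvd (E j) m" "edvd (E l) m" and m: "Poly_Mapping.keys m \<subseteq> {1..n}"
  shows "diff m j l \<in> poly_span n R (pair :: nat \<times> nat \<Rightarrow> nat \<Rightarrow> 'k::field mpoly)"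
proof -
  have *: "diff m j l \<in> poly_span n R (pair :: nat \<times> nat \<Rightarrow> nat \<Rightarrow> 'k mpoly)" if R': "(j, l) \<in> R" and dvd: "edvd (E j) m" "edvd (E l) m" for j l
  proof -
    let ?L = "elcm (E j) (E l)"
    have L: "edvd ?L m" using dvd by (rule elcm_least)
    have mult: "mon (m - ?L) 1 * mon (?L - E j) 1 = mon (m - E j) (1 :: 'k)"
      "mon (m - ?L) 1 * mon (?L - E l) 1 = mon (m - E l) (1 :: 'k)"
      by (simp_all add: mult_single edvd_diff_diff[OF edvd_elcm(1) L] edvd_diff_diff[OF edvd_elcm(2) L])
    have "diff m j l = (\<lambda>i. mon (m - ?L) 1 * (pair (j, l) i :: 'k mpoly))"
    proof
      fix i show "diff m j l i = mon (m - ?L) 1 * (pair (j, l) i :: 'k mpoly)"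
        using mult by (cases "i = j"; cases "i = l"; simp add: diff_def pair_def right_diff_distrib)
    qed
    also have "\<dots> \<in> poly_span n R pair"
      using R R' m keys_diff_expo[of m ?L]
      by (intro poly_span_scale poly_span_base poly_ring_single) auto
    finally show ?thesis .
  qed
  have swap: "diff m j l = (\<lambda>i. - (diff m l j i :: 'k mpoly))" by (rule ext) (simp add: diff_def)
  consider "(j, l) \<in> R" | "(l, j) \<in> R" | "j = l" using jl by blast
  then show ?thesis
  proof cases
    case 1 then show ?thesis using * dvd by blast
  next
    case 2 then show ?thesis unfolding swap using * dvd by (intro poly_span_uminus) blast
  next
    case 3
    then have "diff m j l = (\<lambda>i. 0 :: 'k mpoly)" by (simp add: diff_def)
    then show ?thesis by (simp only: poly_span_0)
  qed
qed

text \<open>In degree \<open>m\<close> a syzygy is a list of scalars \<open>a j\<close> for the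
  generators whose exponent divides \<open>m\<close>, and being a syzygy means that they sum to
  zero. With a fixed base point \<open>t\<close> it is therefore the combination of the relations
  \<open>diff m j t\<close> with coefficients \<open>a j\<close>.\<close>

lemma span_pairs_eq_syz:
  assumes R: "R \<subseteq> pair_indices"
    and diff: "\<And>m j l. j < s \<Longrightarrow> l < s \<Longrightarrow> edvd (E j) m \<Longrightarrow> edvd (E l) m
      \<Longrightarrow> Poly_Mapping.keys m \<subseteq> {1..n} \<Longrightarrow> diff m j l \<in> poly_span n R (pair :: nat \<times> nat \<Rightarrow> nat \<Rightarrow> 'k::field mpoly)"
  shows "poly_span n R pair = syz n {..<s} (gen :: nat \<Rightarrow> nat \<Rightarrow> 'k::field mpoly)"
proof
  show "poly_span n R pair \<subseteq> syz n {..<s} (gen :: nat \<Rightarrow> nat \<Rightarrow> 'k mpoly)"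
  proof (rule poly_span_subset_syz)
    fix q assume "q \<in> R"
    then obtain j l where q: "q = (j, l)" "j < s" "l < s" using R by (auto simp: pair_indices_def)
    have "Poly_Mapping.keys (elcm (E j) (E l)) \<subseteq> {1..n}"
      unfolding elcm_def keys_add_expo
      using keys_diff_expo[of "E l" "E j"] keys_E q vertices by blast
    then show "pair q \<in> syz n {..<s} (gen :: nat \<Rightarrow> nat \<Rightarrow> 'k mpoly)"
      unfolding q(1) pair_def prod.case using q by (intro diff_syz) auto
  qed
  show "syz n {..<s} (gen :: nat \<Rightarrow> nat \<Rightarrow> 'k mpoly) \<subseteq> poly_span n R pair"
  proof (rule syz_subset_poly_spanI[OF _ gen_homogeneous])
    fix c :: "nat \<Rightarrow> 'k mpoly" and m :: expo
    assume c: "c \<in> syz n {..<s} gen" and m: "Poly_Mapping.keys m \<subseteq> {1..n}"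
    define T where "T = {j. j < s \<and> edvd (E j) m}"
    define a where "a j = coeff (c j) (m - E j)" for j
    have finT: "finite T" by (simp add: T_def)
    have comp: "component (E j) m (c j) = (if j \<in> T then mon (m - E j) (a j) else 0)" for j
      using syzD(2)[OF c, of j] by (auto simp: component_def T_def a_def)
    show "(\<lambda>j. component (E j) m (c j)) \<in> poly_span n R pair"
    proof (cases "T = {}")
      case True
      then show ?thesis by (simp add: comp poly_span_0)
    next
      case False
      then obtain t where t: "t \<in> T" by blast
      have "(\<Sum>j<s. component (E j) m (c j) * gen j 0) = (\<Sum>j<s. if j \<in> T then mon m (a j) else 0)"
        by (rule sum.cong)
          (auto simp: comp gen_def block_monomial_eq mult_single edvd_diff_add T_def)
      also have "\<dots> = (\<Sum>j\<in>T. mon m (a j))"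
        by (subst sum.inter_restrict[symmetric]) (auto simp: T_def intro: sum.cong)
      finally have "(\<Sum>j\<in>T. mon m (a j)) = 0"
        using syzD(3)[OF syz_component[OF gen_homogeneous c], of m 0] by simp
      then have "coeff (\<Sum>j\<in>T. mon m (a j)) m = 0" by simp
      then have sum0: "(\<Sum>j\<in>T. a j) = 0" by (simp add: lookup_sum)
      have "(\<Sum>j\<in>T. mon 0 (a j) * diff m j t i) = component (E i) m (c i)" for i
      proof -
        have "(\<Sum>j\<in>T. mon 0 (a j) * diff m j t i) = (\<Sum>j\<in>T. if i = j then mon (m - E j) (a j) else 0)
            - (\<Sum>j\<in>T. if i = t then mon (m - E t) (a j) else 0)"
          unfolding sum_subtractf[symmetric]
          by (rule sum.cong) (auto simp: diff_def mult_single right_diff_distrib)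
        also have "(\<Sum>j\<in>T. if i = t then mon (m - E t) (a j) else 0) = 0"
        proof (rule poly_mapping_eqI)
          fix w
          show "coeff (\<Sum>j\<in>T. if i = t then mon (m - E t) (a j) else 0) w = coeff 0 w"
            using sum0 by (cases "i = t"; cases "m - E t = w") (auto simp: lookup_sum lookup_single)
        qed
        finally show ?thesis using finT by (simp add: comp)
      qed
      then have "(\<lambda>j. component (E j) m (c j)) = (\<lambda>i. \<Sum>j\<in>T. mon 0 (a j) * diff m j t i)" by simp
      also have "\<dots> \<in> poly_span n R pair"
        using t m by (intro poly_span_sum poly_span_scale diff) (auto simp: T_def)
      finally show ?thesis .
    qed
  qed (use vertices keys_E in auto)
qed

lemma span_all_pairs: "poly_span n pair_indices pair = syz n {..<s} (gen :: nat \<Rightarrow> nat \<Rightarrow> 'k::field mpoly)"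
proof (rule span_pairs_eq_syz[OF subset_refl], rule diff_in_span_pairs[OF finite_pair_indices])
  fix j l assume "j < s" "l < s"
  then show "(j, l) \<in> pair_indices \<or> (l, j) \<in> pair_indices \<or> j = l" by (auto simp: pair_indices_def)
qed

text \<open>If \<open>c\<close> divides the least common multiple of \<open>a\<close> and \<open>b\<close>, then the syzygy of \<open>a\<close> and \<open>b\<close> is
  the sum of those of \<open>a\<close>, \<open>c\<close> and of \<open>c\<close>, \<open>b\<close>.\<close>

lemma redundant_pair:
  assumes abc: "a < s" "b < s" "c < s" "c \<noteq> a" "c \<noteq> b" "\<beta> c \<subseteq> \<beta> a \<union> \<beta> b"
  shows "\<exists>R. finite R \<and> card R < s choose 2
    \<and> poly_span n R pair = syz n {..<s} (gen :: nat \<Rightarrow> nat \<Rightarrow> 'k::field mpoly)"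
proof -
  have ab: "a \<noteq> b" using abc block_eqI[of c a] by auto
  define R where "R = pair_indices - {(a, b), (b, a)}"
  have fin: "finite R" using finite_pair_indices by (simp add: R_def)
  have "(a, b) \<in> pair_indices \<or> (b, a) \<in> pair_indices" using abc ab by (auto simp: pair_indices_def)
  then have "R \<subset> pair_indices" unfolding R_def by blast
  then have "card R < s choose 2"
    unfolding card_pair_indices[symmetric] by (intro psubset_card_mono finite_pair_indices)
  moreover have "poly_span n R pair = syz n {..<s} (gen :: nat \<Rightarrow> nat \<Rightarrow> 'k mpoly)"
  proof (rule span_pairs_eq_syz)
    show "R \<subseteq> pair_indices" by (auto simp: R_def)
    fix m j l assume jl: "j < s" "l < s" "edvd (E j) m" "edvd (E l) m"
      and m: "Poly_Mapping.keys m \<subseteq> {1..n}"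
    have other: "(diff m j l :: nat \<Rightarrow> 'k mpoly) \<in> poly_span n R pair"
      if "j < s" "l < s" "edvd (E j) m" "edvd (E l) m" "{j, l} \<noteq> {a, b}" for j l
      using fin _ that(3,4) m
      by (rule diff_in_span_pairs) (use that in \<open>auto simp: R_def pair_indices_def\<close>)
    show "(diff m j l :: nat \<Rightarrow> 'k mpoly) \<in> poly_span n R pair"
    proof (cases "{j, l} = {a, b}")
      case True
      then have "edvd (E a) m" "edvd (E b) m" using jl by (auto simp: doubleton_eq_iff)
      then have "edvd (E c) m" using abc by (simp add: edvd_E) blast
      \<comment> \<open>Since \<open>c\<close> differs from \<open>a\<close> and \<open>b\<close>,
        neither half of the telescoping sum involves the removed pair.\<close>
      then have "diff m j c \<in> poly_span n R (pair :: _ \<Rightarrow> _ \<Rightarrow> 'k mpoly)"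
        "diff m c l \<in> poly_span n R (pair :: _ \<Rightarrow> _ \<Rightarrow> 'k mpoly)"
        using abc jl by (auto intro!: other simp: doubleton_eq_iff)
      then have "(\<lambda>i. diff m j c i + diff m c l i) \<in> poly_span n R (pair :: _ \<Rightarrow> _ \<Rightarrow> 'k mpoly)"
        by (rule poly_span_add)
      moreover have "(\<lambda>i. diff m j c i + diff m c l i) = (diff m j l :: nat \<Rightarrow> 'k mpoly)"
        by (rule ext) (simp add: diff_def)
      ultimately show ?thesis by simp
    next
      case False
      then show ?thesis using other jl by blast
    qed
  qed
  ultimately show ?thesis using fin by blast
qed

section \<open>Minimality of the pair syzygies\<close>

lemma keys_elcm_E: "j < s \<Longrightarrow> l < s \<Longrightarrow> Poly_Mapping.keys (elcm (E j) (E l)) = \<beta> j \<union> \<beta> l"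
  by (auto simp: in_keys_iff lookup_elcm lookup_block_expo finite_block split: if_splits)

text \<open>The pair syzygy of \<open>a\<close> and \<open>b\<close> has the monomial
  \<open>u\<close> at coordinate \<open>a\<close>. A pair of \<open>a\<close> with another block
  \<open>e\<close> could interfere there only if its own entry divided \<open>u\<close>; then
  \<open>E e\<close> would divide the least common multiple for \<open>a\<close> and
  \<open>b\<close>, that is, \<open>e\<close> would be covered.\<close>

lemma pairs_no_unit_syz:
  assumes cf: "cover_free (\<beta> ` {..<s})"
  shows "no_unit_syz n pair_indices (pair :: nat \<times> nat \<Rightarrow> nat \<Rightarrow> 'k::field mpoly)"
  unfolding no_unit_syz_def
proof (intro ballI allI)
  fix c :: "nat \<times> nat \<Rightarrow> 'k mpoly" and q assume c: "c \<in> syz n pair_indices pair"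
  show "coeff (c q) 0 = 0"
  proof (cases "q \<in> pair_indices")
    case True
    then obtain a b where q: "q = (a, b)" "a < s" "b < a" by (auto simp: pair_indices_def)
    define u where "u = elcm (E a) (E b) - E a"
    text \<open>Only the pair \<open>q\<close> contributes to the coefficient of \<open>u\<close> in the component at \<open>a\<close>.\<close>
    have no: "\<not> edvd (elcm (E a) (E e) - E a) u" if e: "e < s" "e \<noteq> a" "e \<noteq> b" for e
    proof
      assume dvd: "edvd (elcm (E a) (E e) - E a) u"
      \<comment> \<open>Both subtractions of \<open>E a\<close> are exact, so the divisibility
        compares the two least common multiples.\<close>
      have "coeff (E e) i \<le> coeff (elcm (E a) (E b)) i" for i
        using dvd[unfolded edvd_def u_def lookup_minus lookup_elcm, rule_format, of i]
        by (simp add: lookup_elcm max_def split: if_splits)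
      then have "edvd (E e) (elcm (E a) (E b))" by (simp add: edvd_def)
      then have "\<beta> e \<subseteq> \<beta> a \<union> \<beta> b" using e q by (simp add: edvd_E keys_elcm_E)
      moreover have "\<beta> e \<noteq> \<beta> a" "\<beta> e \<noteq> \<beta> b" using e q block_eqI[of e a] block_eqI[of e b] by auto
      moreover have "\<beta> a \<in> \<beta> ` {..<s}" "\<beta> b \<in> \<beta> ` {..<s}" "\<beta> e \<in> \<beta> ` {..<s}" using e(1) q by simp_all
      ultimately show False using cf unfolding cover_free_def by blast
    qed
    have "coeff (c p * pair p a) u = (if p = q then coeff (c q) 0 else 0)" if pin: "p \<in> pair_indices" for p
    proof -
      obtain j l where p: "p = (j, l)" "j < s" "l < j" using pin by (auto simp: pair_indices_def)
      consider "j = a" "l = b" | "j = a" "l \<noteq> b" | "l = a" | "j \<noteq> a" "l \<noteq> a" by blast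
      then show ?thesis
      proof cases
        case 1
        then have "pair p a = (mon u 1 :: 'k mpoly)" using q by (simp add: p pair_def diff_def u_def)
        then show ?thesis using 1 p q by (simp add: coeff_mult_single)
      next
        case 2
        then have "pair p a = (mon (elcm (E a) (E l) - E a) 1 :: 'k mpoly)"
          using p by (simp add: pair_def diff_def)
        then show ?thesis using 2 p q no[of l] by (simp add: coeff_mult_single)
      next
        case 3
        then have "pair p a = - (mon (elcm (E a) (E j) - E a) 1 :: 'k mpoly)"
          using p by (simp add: pair_def diff_def elcm_commute)
        then show ?thesis using 3 p q no[of j] by (simp add: coeff_mult_single)
      next
        case 4
        then show ?thesis using p q by (simp add: pair_def diff_def)
      qed
    qed
    then have "coeff (\<Sum>p\<in>pair_indices. c p * pair p a) u = coeff (c q) 0"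
      using True finite_pair_indices by (simp add: lookup_sum cong: sum.cong)
    then show ?thesis using syzD(3)[OF c] by simp
  qed (use syzD(2)[OF c] in auto)
qed

lemma betti_2_eq_iff_cover_free:
  "betti n (block_ideal n (\<beta> ` {..<s}) :: 'k::field mpoly set) 2 = s choose 2
    \<longleftrightarrow> cover_free (\<beta> ` {..<s})"
proof -
  obtain r dg and d :: "nat \<Rightarrow> nat \<Rightarrow> nat \<Rightarrow> 'k mpoly"
    where res: "minimal_free_resolution n (block_ideal n (\<beta> ` {..<s})) r dg d"
      and b2: "betti n (block_ideal n (\<beta> ` {..<s}) :: 'k mpoly set) 2 = r 2"
    using betti_2 by blast
  have "r 2 = s choose 2" if "cover_free (\<beta> ` {..<s})"
  proof (rule antisym)
    show "r 2 \<le> s choose 2"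
      using resolution_second_step_minimal[OF res finite_pair_indices span_all_pairs]
      by (simp add: card_pair_indices)
    obtain G where "poly_span n {..<r 2} G = syz n {..<s} (gen :: nat \<Rightarrow> nat \<Rightarrow> 'k mpoly)"
      using resolution_second_step_generators[OF res] by blast
    then show "s choose 2 \<le> r 2"
      using card_le_of_no_unit_syz[OF finite_pair_indices _ _ pairs_no_unit_syz[OF that], of "{..<r 2}" G]
      by (simp add: card_pair_indices span_all_pairs)
  qed
  moreover have "r 2 < s choose 2" if not_cf: "\<not> cover_free (\<beta> ` {..<s})"
  proof -
    obtain a b c where "a < s" "b < s" "c < s" "\<beta> c \<subseteq> \<beta> a \<union> \<beta> b" "\<beta> c \<noteq> \<beta> a" "\<beta> c \<noteq> \<beta> b"
      using not_cf by (auto simp: cover_free_def)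
    then obtain R where "finite R" "card R < s choose 2"
      "poly_span n R pair = syz n {..<s} (gen :: nat \<Rightarrow> nat \<Rightarrow> 'k mpoly)"
      using redundant_pair[of a b c] by blast
    then show ?thesis using resolution_second_step_minimal[OF res, of R] by fastforce
  qed
  ultimately show ?thesis unfolding b2 by (metis less_irrefl)
qed

end

theorem theorem2p8:
  fixes n :: nat and B :: "nat set set"
  assumes "n > 4" and "B \<subseteq> blocks 3 n"
  shows "STS n B \<longleftrightarrow>
     real (betti n (block_ideal n B :: 'k::field mpoly set) 1) = real n * (real n - 1) / 6 \<and>
     real (betti n (block_ideal n B :: 'k::field mpoly set) 2)
       = (real n * (real n - 1) / 6) gchoose 2"
proof -
  have B: "b \<subseteq> {1..n} \<and> card b = 3" if "b \<in> B" for b using assms(2) that by (auto simp: blocks_def)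
  have "finite B" using B by (meson Pow_iff finite_Pow_iff finite_subset subsetI finite_atLeastAtMost)
  then obtain \<beta> where \<beta>: "bij_betw \<beta> {..<card B} B"
    using ex_bij_betw_nat_finite[of B] by (auto simp: lessThan_atLeast0)
  then have img: "\<beta> ` {..<card B} = B" by (simp add: bij_betw_def)
  interpret block_family n 3 "card B" \<beta>
  proof
    show "inj_on \<beta> {..<card B}" using \<beta> by (simp add: bij_betw_def)
    show "\<beta> j \<subseteq> {1..n}" "card (\<beta> j) = 3" if "j < card B" for j
      using B img that by blast+
  qed simp
  have b1: "betti n (block_ideal n B :: 'k mpoly set) 1 = card B"
    using betti_1 unfolding img .
  have b2: "betti n (block_ideal n B :: 'k mpoly set) 2 = card B choose 2 \<longleftrightarrow> cover_free B"
    using betti_2_eq_iff_cover_free unfolding img .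
  have card: "6 * card B = n * (n - 1) \<longleftrightarrow> real (card B) = real n * (real n - 1) / 6"
  proof -
    have "6 * card B = n * (n - 1) \<longleftrightarrow> real (6 * card B) = real (n * (n - 1))"
      by (simp only: of_nat_eq_iff)
    also have "\<dots> \<longleftrightarrow> real (card B) = real n * (real n - 1) / 6"
      using assms(1) by (simp add: of_nat_diff) linarith
    finally show ?thesis .
  qed
  have "STS n B \<longleftrightarrow> real (card B) = real n * (real n - 1) / 6 \<and>
      real (betti n (block_ideal n B :: 'k mpoly set) 2) = real (card B choose 2)"
    unfolding STS_iff_cover_free[OF assms] card of_nat_eq_iff b2 by blast
  \<comment> \<open>Under the first conjunct the generalized binomial is taken at the natural number
    \<open>card B\<close>, where it is the ordinary one.\<close>
  also have "\<dots> \<longleftrightarrow> real (card B) = real n * (real n - 1) / 6 \<and>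
      real (betti n (block_ideal n B :: 'k mpoly set) 2) = (real n * (real n - 1) / 6) gchoose 2"
    unfolding binomial_gbinomial by metis
  finally show ?thesis unfolding b1 .
qed

end
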